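(* Let $g$ be a geodesic in the hyperbolic plane $\mathbb{H}^2$ and let $\gamma$ be an isometry of $\mathbb{H}^2$ such that for all $i\in\mathbb{Z}$: (1) either $g\cap\gamma^i g=\emptyset$ or $g=\gamma^i g$; and (2) the geodesics $\gamma^i g$ (those different from $g$) are in the same component of the complement of $g$. Let $H$ be the half space with respect to $g$ that does not contain the geodesics $\gamma^i g$, let $\mathcal{G}_0$ be a collection of disjoint geodesics in $H$, and put $\mathcal{G}_i:=\gamma^i(\mathcal{G}_0)$ for $i\in\mathbb{Z}$. Let $C_{2n}$ be the cycle graph of length $2n$ and $\widetilde{C_{2n}}$ its universal covering, with vertices labelled $v_i$, $i\in\mathbb{Z}$, so that for each $i$ the vertices $v_{i-1}$ and $v_i$ are joined by an edge and a chosen generator $t$ of the covering transformation group satisfies $t(v_i)=v_{i+2n}$. Let $X'$ be an $n$-point subset of the vertex set $V(C_{2n})$, let $X\subset V(\widetilde{C_{2n}})$ be the pre-image of $X'$, and let $\overline{X}$ be the complement of $X$ in $V(\widetilde{C_{2n}})$. Define $$\mathcal{G}_X:=\bigcup_{v_i\in X}\mathcal{G}_i,\qquad \mathcal{G}_{\overline{X}}:=\bigcup_{v_i\in\overline{X}}\mathcal{G}_i.$$ Then the two collections $\mathcal{G}_X$ and $\mathcal{G}_{\overline{X}}$ have the same ortho spectrum, that is, $\mathcal{O}(\mathcal{G}_X)=\mathcal{O}(\mathcal{G}_{\overline{X}})$.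
   Context: Disjoint geodesics are allowed to be asymptotic. For a collection $\mathcal{G}$ of mutually disjoint (possibly asymptotic) geodesics in $\mathbb{H}^2$, an ortho geodesic is a geodesic (segment) each of whose two endpoints is orthogonal to an element of $\mathcal{G}$. The ortho spectrum $\mathcal{O}(\mathcal{G})$ is the set of the lengths of ortho geodesics, counted with multiplicity.
   Formalization: For γ of finite order the claim can fail for plain unions; equality is stated for them when γ^i determines whether v_i is in X (automatic if γ has infinite order), and without restriction when the union of the G_i is taken with repetitions. *)

theory Defs
  imports "HOL-Analysis.Analysis" "HOL-Library.Equipollence"
begin

section \<open>The hyperbolic plane (upper half-plane model)\<close>

definition H2 :: "complex set" where
  "H2 = {z. 0 < Im z}"

definition hdist :: "complex \<Rightarrow> complex \<Rightarrow> real" where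
  "hdist z w = arcosh (1 + (cmod (z - w))\<^sup>2 / (2 * Im z * Im w))"

definition hisometry :: "(complex \<Rightarrow> complex) \<Rightarrow> bool" where
  "hisometry \<gamma> \<longleftrightarrow> bij_betw \<gamma> H2 H2 \<and> (\<forall>z\<in>H2. \<forall>w\<in>H2. hdist (\<gamma> z) (\<gamma> w) = hdist z w)"

definition iso_pow :: "(complex \<Rightarrow> complex) \<Rightarrow> int \<Rightarrow> complex \<Rightarrow> complex" where
  "iso_pow \<gamma> i = (if 0 \<le> i then \<gamma> ^^ nat i else (inv_into H2 \<gamma>) ^^ nat (- i))"

definition unit_speed_geodesic :: "(real \<Rightarrow> complex) \<Rightarrow> bool" where
  "unit_speed_geodesic c \<longleftrightarrow> (\<forall>t. c t \<in> H2) \<and> (\<forall>s t. hdist (c s) (c t) = \<bar>s - t\<bar>)"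

definition hgeodesic :: "complex set \<Rightarrow> bool" where
  "hgeodesic g \<longleftrightarrow> (\<exists>c. unit_speed_geodesic c \<and> g = range c)"

text \<open>The half-plane model is conformal, so a right angle in the hyperbolic metric is a right
  angle between the Euclidean tangent vectors. Unit-speed geodesics are smooth with non-vanishing
  derivative, so asking for the derivatives to exist is no restriction.\<close>

definition meets_orthogonally :: "(real \<Rightarrow> complex) \<Rightarrow> real \<Rightarrow> complex set \<Rightarrow> bool" where
  "meets_orthogonally c t a \<longleftrightarrow>
     (\<exists>d t' u v. unit_speed_geodesic d \<and> range d = a \<and> d t' = c t \<and>
        (c has_vector_derivative u) (at t) \<and> (d has_vector_derivative v) (at t') \<and> u \<bullet> v = 0)"

section \<open>Ortho geodesics and the ortho spectrum\<close>

text \<open>A segment is represented by its point set, hence unoriented; it is non-degenerate.\<close>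

definition ortho_segment :: "complex set \<Rightarrow> real \<Rightarrow> complex set \<Rightarrow> complex set \<Rightarrow> bool" where
  "ortho_segment s L a b \<longleftrightarrow>
     (\<exists>c. unit_speed_geodesic c \<and> 0 < L \<and> s = c ` {0..L} \<and>
        meets_orthogonally c 0 a \<and> meets_orthogonally c L b)"

definition ortho_geodesics :: "complex set set \<Rightarrow> real \<Rightarrow> complex set set" where
  "ortho_geodesics \<G> L = {s. \<exists>a\<in>\<G>. \<exists>b\<in>\<G>. ortho_segment s L a b}"

text \<open>The spectrum assigns to every length its multiplicity, i.e. the cardinality of the set of
  ortho geodesics of that length. Multiplicities may be infinite (and are, for a collection
  invariant under a translation), so the cardinality is taken as an equipollence class.\<close>

definition ortho_spectrum :: "complex set set \<Rightarrow> real \<Rightarrow> complex set set set" where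
  "ortho_spectrum \<G> L = {S. S \<approx> ortho_geodesics \<G> L}"

text \<open>The same for a family \<open>(c i)\<close>, \<open>i \<in> I\<close>, of geodesics in which a geodesic may be repeated:
  an ortho geodesic is counted once for each choice of the (unordered) pair of members of the
  family which it joins. For an injective family this agrees with the spectrum of the set
  \<open>c ` I\<close>.\<close>

definition ortho_geodesics_family ::
  "'i set \<Rightarrow> ('i \<Rightarrow> complex set) \<Rightarrow> real \<Rightarrow> (complex set \<times> 'i set) set" where
  "ortho_geodesics_family I c L =
     {(s, {i, j}) | s i j. i \<in> I \<and> j \<in> I \<and> ortho_segment s L (c i) (c j)}"

definition ortho_spectrum_family ::
  "'i set \<Rightarrow> ('i \<Rightarrow> complex set) \<Rightarrow> real \<Rightarrow> (complex set \<times> 'i set) set set" where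
  "ortho_spectrum_family I c L = {S. S \<approx> ortho_geodesics_family I c L}"

section \<open>The cycle of length \<open>2 n\<close> and its universal covering\<close>

text \<open>The vertex \<open>v\<^sub>i\<close> of the universal covering (a line, with \<open>v\<^sub>i\<^sub>-\<^sub>1\<close> joined to \<open>v\<^sub>i\<close>) is the integer
  \<open>i\<close>, and \<open>t i = i + 2 * n\<close>. The cycle is the quotient by \<open>t\<close>; its vertices are the residues
  modulo \<open>2 * n\<close>.\<close>

definition cycle_vertices :: "nat \<Rightarrow> int set" where
  "cycle_vertices n = {0..<2 * int n}"

definition covering_map :: "nat \<Rightarrow> int \<Rightarrow> int" where
  "covering_map n i = i mod (2 * int n)"

definition translate :: "(complex \<Rightarrow> complex) \<Rightarrow> complex set set \<Rightarrow> int \<Rightarrow> complex set set" where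
  "translate \<gamma> \<G>\<^sub>0 i = (\<lambda>a. iso_pow \<gamma> i ` a) ` \<G>\<^sub>0"

definition collection_over :: "(complex \<Rightarrow> complex) \<Rightarrow> complex set set \<Rightarrow> int set \<Rightarrow> complex set set" where
  "collection_over \<gamma> \<G>\<^sub>0 X = (\<Union>i\<in>X. translate \<gamma> \<G>\<^sub>0 i)"

text \<open>The union of the collections \<open>translate \<gamma> \<G>\<^sub>0 i\<close>, \<open>i \<in> X\<close>, taken with repetitions: the
  family of the \<open>iso_pow \<gamma> i ` a\<close> indexed by \<open>(i, a) \<in> X \<times> \<G>\<^sub>0\<close>.\<close>

definition family_spectrum_over ::
  "(complex \<Rightarrow> complex) \<Rightarrow> complex set set \<Rightarrow> int set \<Rightarrow> real
     \<Rightarrow> (complex set \<times> (int \<times> complex set) set) set set" where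
  "family_spectrum_over \<gamma> \<G>\<^sub>0 X = ortho_spectrum_family (X \<times> \<G>\<^sub>0) (\<lambda>(i, a). iso_pow \<gamma> i ` a)"

text \<open>If \<open>\<gamma>\<close> has infinite order, this holds for every \<open>X\<close>. If \<open>\<gamma>\<close> has finite order, it says that
  the isometry \<open>\<gamma>\<^sup>i\<close> determines whether \<open>i \<in> X\<close>. Without it the spectra of the unions as plain
  sets can differ: let \<open>\<gamma>\<close> be a rotation of order 5, \<open>n = 5\<close>, \<open>\<G>\<^sub>0\<close> a single geodesic and
  \<open>X' = {0, 1, 3, 5, 6}\<close>. Then \<open>X\<close> meets the residues \<open>0, 1, 3\<close> modulo 5 and its complement the
  residues \<open>2, 3, 4\<close>; the lengths are \<open>x, y, y\<close> in the first case and \<open>x, x, y\<close> in the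
  second.\<close>

definition compatible_with_order :: "(complex \<Rightarrow> complex) \<Rightarrow> int set \<Rightarrow> bool" where
  "compatible_with_order \<gamma> X \<longleftrightarrow>
     (\<forall>m. (\<forall>z\<in>H2. iso_pow \<gamma> m z = z) \<longrightarrow> (\<forall>i. i \<in> X \<longleftrightarrow> i + m \<in> X))"

end

theory Submission
  imports Defs
begin

text \<open>
  The shifts of the universal covering act through \<open>\<gamma>\<close> on the ortho geodesics joining members of the
  collections \<open>\<G>\<^sub>i\<close> and \<open>\<G>\<^sub>j\<close>. By the hexachord theorem, two translates of \<open>X\<close> overlap in a period as
  often as the same translates of its complement. Hence the finitely many translates of the set
  \<open>A\<close> of ortho geodesics of \<open>\<G>\<^sub>X\<close> have the same union as those of the set \<open>B\<close> for the complement. If \<open>A\<close>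
  or \<open>B\<close> is infinite, each is equipollent to this union. This covers free actions, in particular
  families with repetitions and \<open>\<gamma>\<close> of infinite order, because an isometry that preserves a
  segment has trivial fourth power. If \<open>A\<close> and \<open>B\<close> are finite, they are compared by double counting,
  which needs that an ortho geodesic determines the two indices modulo the order of \<open>\<gamma>\<close>. It does,
  because its end points lie in translates of \<open>H\<close>, and for \<open>\<gamma>\<close> of finite order different
  translates are disjoint unless \<open>\<gamma>\<close> is an involution; for an involution, \<open>X\<close> is the set of
  even or of odd numbers, and \<open>\<gamma>\<close> itself maps \<open>A\<close> to \<open>B\<close>.
\<close>

section \<open>Balanced periodic sets of integers\<close>

locale balanced_set =
  fixes X :: "int set" and n :: nat
  assumes period: "i + 2 * int n \<in> X \<longleftrightarrow> i \<in> X" and n_ge_1: "1 \<le> n"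
    and card_period: "card (X \<inter> {0..<2 * int n}) = n"
begin

lemma add_multiple_mem_iff: "i + 2 * int n * l \<in> X \<longleftrightarrow> i \<in> X"
proof -
  have *: "i + 2 * int n * int k \<in> X \<longleftrightarrow> i \<in> X" for i k
    by (induction k) (use period[of "i + 2 * int n * int k" for k] in \<open>auto simp: algebra_simps\<close>)
  show ?thesis
  proof (cases "l \<ge> 0")
    case True
    then show ?thesis using *[of i "nat l"] by simp
  next
    case False
    then show ?thesis using *[of "i + 2 * int n * l" "nat (- l)"] by simp
  qed
qed

lemma mod_mem_iff: "i mod (2 * int n) \<in> X \<longleftrightarrow> i \<in> X"
  using add_multiple_mem_iff[of "i mod (2 * int n)" "i div (2 * int n)"] by simp

lemma add_mod_mem_iff: "i + k mod (2 * int n) \<in> X \<longleftrightarrow> i + k \<in> X"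
  using add_multiple_mem_iff[of "i + k mod (2 * int n)" "k div (2 * int n)"]
  by (simp add: add.assoc)

text \<open>Reduction modulo \<open>2 * int n\<close> carries the window starting at
  \<open>r\<close> bijectively to the fundamental period and respects membership in
  \<open>X\<close>.\<close>

lemma card_translate: "card {k \<in> {0..<2 * int n}. r + k \<in> X} = n"
proof -
  let ?N = "2 * int n"
  have N: "?N > 0" using n_ge_1 by simp
  have "bij_betw (\<lambda>k. (r + k) mod ?N) {k \<in> {0..<?N}. r + k \<in> X} (X \<inter> {0..<?N})"
  proof (rule bij_betw_byWitness[where f' = "\<lambda>k. (k - r) mod ?N"])
    show "(\<lambda>k. (k - r) mod ?N) ` (X \<inter> {0..<?N}) \<subseteq> {k \<in> {0..<?N}. r + k \<in> X}"
    proof safe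
      fix i assume "i \<in> X" "i \<in> {0..<?N}"
      then have "(r + (i - r) mod ?N) mod ?N = i" by (simp add: mod_add_right_eq)
      then show "r + (i - r) mod ?N \<in> X" using mod_mem_iff \<open>i \<in> X\<close> by metis
    qed (use N in auto)
  qed (use N mod_mem_iff in \<open>auto simp: mod_diff_left_eq mod_add_right_eq\<close>)
  from bij_betw_same_card[OF this] card_period show ?thesis by simp
qed

text \<open>The hexachord theorem: both translates of \<open>X\<close> fill half of a period, hence they overlap as
  much as their complements do.\<close>

lemma hexachord:
  "card {k \<in> {0..<2 * int n}. p + k \<in> X \<and> q + k \<in> X} =
   card {k \<in> {0..<2 * int n}. p + k \<notin> X \<and> q + k \<notin> X}"
proof -
  let ?I = "{0..<2 * int n}"
  have fin: "finite {k \<in> ?I. Q k}" for Q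
    by (rule finite_subset[of _ ?I]) auto
  let ?S = "{k \<in> ?I. p + k \<in> X}" and ?T = "{k \<in> ?I. q + k \<in> X}"
  have "card ?S + card ?T = card (?S \<union> ?T) + card (?S \<inter> ?T)"
    by (rule card_Un_Int[OF fin fin])
  \<comment> \<open>The two sizes add up to a whole period, so the elements counted twice are as
    many as those missed by both sets.\<close>
  then have 1: "2 * n = card (?S \<union> ?T) + card (?S \<inter> ?T)"
    using card_translate[of p] card_translate[of q] by simp
  have "card (?I - (?S \<union> ?T)) = card ?I - card (?S \<union> ?T)"
    by (rule card_Diff_subset) (use fin in auto)
  with 1 have 2: "card (?S \<inter> ?T) = card (?I - (?S \<union> ?T))" by simp
  have "?S \<inter> ?T = {k \<in> ?I. p + k \<in> X \<and> q + k \<in> X}"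
    "?I - (?S \<union> ?T) = {k \<in> ?I. p + k \<notin> X \<and> q + k \<notin> X}" by auto
  with 2 show ?thesis by simp
qed

lemma balanced_set_Compl: "balanced_set (- X) n"
proof
  show "i + 2 * int n \<in> - X \<longleftrightarrow> i \<in> - X" for i using period by simp
  show "1 \<le> n" by (rule n_ge_1)
  have "{k \<in> {0..<2 * int n}. 0 + k \<in> X \<and> 0 + k \<in> X} = X \<inter> {0..<2 * int n}"
    "{k \<in> {0..<2 * int n}. 0 + k \<notin> X \<and> 0 + k \<notin> X} = - X \<inter> {0..<2 * int n}" by auto
  then show "card (- X \<inter> {0..<2 * int n}) = n"
    using hexachord[of 0 0] card_period by metis
qed

text \<open>The qualitative form of \<open>hexachord\<close>: one count vanishes only if the other
  does.\<close>

lemma common_translate_Compl: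
  assumes "p + k \<in> X" "q + k \<in> X"
  obtains l where "p + l \<notin> X" "q + l \<notin> X"
proof -
  let ?I = "{0..<2 * int n}"
  have "k mod (2 * int n) \<in> {k \<in> ?I. p + k \<in> X \<and> q + k \<in> X}"
    using assms n_ge_1 by (simp add: add_mod_mem_iff)
  moreover have "finite {k \<in> ?I. p + k \<in> X \<and> q + k \<in> X}"
    by (rule finite_subset[of _ ?I]) auto
  ultimately have "card {k \<in> ?I. p + k \<in> X \<and> q + k \<in> X} \<noteq> 0"
    by (auto simp only: card_0_eq empty_iff)
  then have "card {k \<in> ?I. p + k \<notin> X \<and> q + k \<notin> X} \<noteq> 0"
    by (simp only: hexachord not_False_eq_True)
  then obtain l where "l \<in> {k \<in> ?I. p + k \<notin> X \<and> q + k \<notin> X}"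
    by (metis (lifting) all_not_in_conv card.empty)
  then show ?thesis using that by blast
qed

lemma ex_mem: "\<exists>i. i \<in> X"
proof (rule ccontr)
  assume "\<nexists>i. i \<in> X"
  then have "X \<inter> {0..<2 * int n} = {}" by blast
  then have "card (X \<inter> {0..<2 * int n}) = 0" by (simp only: card.empty)
  then show False using card_period n_ge_1 by simp
qed

text \<open>Period 2 leaves only unions of parity classes, and a balanced set is neither empty nor
  everything. This serves the case of an involution.\<close>

lemma period_2_alternating:
  assumes period2: "\<And>i. i + 2 \<in> X \<longleftrightarrow> i \<in> X"
  shows "i + 1 \<in> X \<longleftrightarrow> i \<notin> X"
proof -
  have even: "j + 2 * k \<in> X \<longleftrightarrow> j \<in> X" for j k
  proof (induction k rule: int_induct[where k = 0])
    case (step1 k)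
    then show ?case using period2[of "j + 2 * k"] by (simp add: algebra_simps)
  next
    case (step2 k)
    then show ?case using period2[of "j + 2 * (k - 1)"] by (simp add: algebra_simps)
  qed simp
  have cover: "\<exists>k. j = i + 2 * k \<or> j = i + 1 + 2 * k" for j by presburger
  show ?thesis
  proof
    show "i \<notin> X" if "i + 1 \<in> X"
    proof
      assume "i \<in> X"
      then have "j \<in> X" for j using cover[of j] even that by metis
      then show False using balanced_set.ex_mem[OF balanced_set_Compl] by simp
    qed
    show "i + 1 \<in> X" if "i \<notin> X"
    proof (rule ccontr)
      assume "i + 1 \<notin> X"
      then have "j \<notin> X" for j using cover[of j] even that by metis
      then show False using ex_mem by simp
    qed
  qed
qed

end

section \<open>Objects joining pairs of indices under a shift action\<close>

text \<open>Intended reading of \<open>R i j s\<close>: the object \<open>s\<close> joins a member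
  of the \<open>i\<close>-th collection to one of the \<open>j\<close>-th; \<open>P\<close> is the
  action of the shifts. The action laws are restricted to such \<open>s\<close> because
  \<open>iso_pow\<close> is a group action only on \<open>H2\<close>.\<close>

locale balanced_joining = balanced_set +
  fixes R :: "int \<Rightarrow> int \<Rightarrow> 'a \<Rightarrow> bool" and P :: "int \<Rightarrow> 'a \<Rightarrow> 'a"
  assumes R_shift: "R i j s \<Longrightarrow> R (i + k) (j + k) (P k s)"
    and P_add: "R i j s \<Longrightarrow> P k (P l s) = P (k + l) s"
    and P_0: "R i j s \<Longrightarrow> P 0 s = s"
begin

definition joined :: "int set \<Rightarrow> 'a set" where
  "joined Y = {s. \<exists>i\<in>Y. \<exists>j\<in>Y. R i j s}"

text \<open>The union of all \<open>P\<close>-translates of \<open>joined Y\<close>, expressed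
  through indices, so that comparing \<open>Y\<close> with its complement becomes a question about
  integers.\<close>

definition joined_shift :: "int set \<Rightarrow> 'a set" where
  "joined_shift Y = {s. \<exists>i j k. i + k \<in> Y \<and> j + k \<in> Y \<and> R i j s}"

lemma P_minus: "R i j s \<Longrightarrow> P (- k) (P k s) = s"
  by (simp add: P_add P_0)

lemma joined_subset_joined_shift: "joined Y \<subseteq> joined_shift Y"
proof
  fix s assume "s \<in> joined Y"
  then obtain i j where "i + 0 \<in> Y" "j + 0 \<in> Y" "R i j s" by (auto simp: joined_def)
  then show "s \<in> joined_shift Y" unfolding joined_shift_def by blast
qed

lemma P_joined_shift: "P k ` joined_shift Y = joined_shift Y"
proof -
  have *: "P k s \<in> joined_shift Y" if "s \<in> joined_shift Y" for k s
  proof -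
    from that obtain i j l where "i + l \<in> Y" "j + l \<in> Y" "R i j s"
      by (auto simp: joined_shift_def)
    then have "(i + k) + (l - k) \<in> Y" "(j + k) + (l - k) \<in> Y" "R (i + k) (j + k) (P k s)"
      by (auto simp: R_shift)
    then show ?thesis unfolding joined_shift_def by blast
  qed
  have "s \<in> P k ` joined_shift Y" if s: "s \<in> joined_shift Y" for s
  proof (rule image_eqI)
    show "s = P k (P (- k) s)"
      using s P_minus[of _ _ s "- k"] by (auto simp: joined_shift_def)
  qed (rule *[OF s])
  with * show ?thesis by blast
qed

lemma inj_on_P_joined_shift: "inj_on (P k) (joined_shift Y)"
  by (rule inj_on_inverseI[where g = "P (- k)"]) (auto simp: joined_shift_def P_minus)

text \<open>Membership in \<open>X\<close> depends on a shift only modulo \<open>2 * int n\<close>,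
  so the shifts of one period suffice even if \<open>P\<close> itself is not periodic. The union
  being finite is what the comparison of cardinalities rests on.\<close>

lemma joined_shift_eq_UN: "joined_shift X = (\<Union>k\<in>{0..<2 * int n}. P (- k) ` joined X)"
proof
  show "joined_shift X \<subseteq> (\<Union>k\<in>{0..<2 * int n}. P (- k) ` joined X)"
  proof
    fix s assume "s \<in> joined_shift X"
    then obtain i j k where *: "i + k \<in> X" "j + k \<in> X" "R i j s"
      by (auto simp: joined_shift_def)
    let ?k = "k mod (2 * int n)"
    have "P ?k s \<in> joined X"
      using * R_shift[OF *(3), of ?k] unfolding joined_def by (auto simp: add_mod_mem_iff intro!: bexI)
    moreover have "s = P (- ?k) (P ?k s)" using *(3) P_minus by metis
    moreover have "?k \<in> {0..<2 * int n}" using n_ge_1 by simp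
    ultimately show "s \<in> (\<Union>k\<in>{0..<2 * int n}. P (- k) ` joined X)" by blast
  qed
  show "(\<Union>k\<in>{0..<2 * int n}. P (- k) ` joined X) \<subseteq> joined_shift X"
    using joined_subset_joined_shift P_joined_shift by blast
qed

text \<open>A finite union of images of an infinite set is no larger than the set.\<close>

lemma infinite_joined_eqpoll: "infinite (joined X) \<Longrightarrow> joined X \<approx> joined_shift X"
proof -
  assume inf: "infinite (joined X)"
  have "(card_of (\<Union>k\<in>{0..<2 * int n}. P (- k) ` joined X), card_of (joined X)) \<in> ordLeq"
  proof (rule card_of_UNION_ordLeq_infinite[OF inf])
    show "(card_of {0..<2 * int n}, card_of (joined X)) \<in> ordLeq"
      using inf finite_lepoll_infinite[of "joined X" "{0..<2 * int n}"]
      by (simp add: lepoll_def card_of_ordLeq)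
  qed (simp add: card_of_image)
  then have "joined_shift X \<lesssim> joined X"
    unfolding joined_shift_eq_UN lepoll_def card_of_ordLeq[symmetric] .
  then show ?thesis
    by (simp add: joined_subset_joined_shift lepoll_antisym subset_imp_lepoll)
qed

lemma finite_joined_shift_iff: "finite (joined_shift X) \<longleftrightarrow> finite (joined X)"
proof
  show "finite (joined X)" if "finite (joined_shift X)"
    using joined_subset_joined_shift that by (rule finite_subset)
qed (simp add: joined_shift_eq_UN)

lemma balanced_joining_Compl: "balanced_joining (- X) n R P"
  using balanced_set_Compl R_shift P_add P_0
  by (auto simp: balanced_joining_def balanced_joining_axioms_def)

text \<open>By \<open>common_translate_Compl\<close>, a shift taking both indices into a balanced
  set can be replaced by one taking both into its complement.\<close>

lemma joined_shift_Compl: "joined_shift (- X) = joined_shift X"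
proof -
  have *: "joined_shift Y \<subseteq> joined_shift (- Y)" if "balanced_set Y n" for Y
  proof
    fix s assume "s \<in> joined_shift Y"
    then obtain i j k where "i + k \<in> Y" "j + k \<in> Y" "R i j s" by (auto simp: joined_shift_def)
    moreover from balanced_set.common_translate_Compl[OF that this(1,2)]
    obtain l where "i + l \<in> - Y" "j + l \<in> - Y" by auto
    ultimately show "s \<in> joined_shift (- Y)" unfolding joined_shift_def by blast
  qed
  from *[OF balanced_set_axioms] *[OF balanced_set_Compl] show ?thesis by simp
qed

lemma infinite_joined_eqpoll_Compl:
  assumes "infinite (joined X)"
  shows "joined X \<approx> joined (- X)"
proof -
  interpret C: balanced_joining "- X" n R P by (rule balanced_joining_Compl)
  have "infinite (joined (- X))"
    using assms finite_joined_shift_iff C.finite_joined_shift_iff by (simp add: joined_shift_Compl)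
  from C.infinite_joined_eqpoll[OF this] infinite_joined_eqpoll[OF assms] show ?thesis
    by (metis joined_shift_Compl eqpoll_sym eqpoll_trans)
qed

text \<open>The shifts by periods of \<open>X\<close> keep an element in \<open>joined X\<close>
  and, by freeness, produce infinitely many others from it. So \<open>joined X\<close> is empty or
  infinite.\<close>

lemma free_joined_eqpoll_Compl:
  assumes free: "\<And>i j s k. R i j s \<Longrightarrow> P k s = s \<Longrightarrow> k = 0"
  shows "joined X \<approx> joined (- X)"
proof (cases "joined X = {}")
  case True
  then have "joined_shift X = {}" unfolding joined_shift_eq_UN by simp
  then show ?thesis
    using True joined_subset_joined_shift[of "- X"] by (simp add: joined_shift_Compl)
next
  case False
  then obtain i j s where s: "i \<in> X" "j \<in> X" "R i j s" unfolding joined_def by blast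
  have "inj (\<lambda>k. P (2 * int n * k) s)"
  proof (rule injI)
    fix k l :: int assume "P (2 * int n * k) s = P (2 * int n * l) s"
    then have "P (- (2 * int n * k)) (P (2 * int n * l) s) = s"
      using P_minus[OF s(3)] by metis
    then have "P (- (2 * int n * k) + 2 * int n * l) s = s"
      using P_add[OF s(3)] by metis
    from free[OF s(3) this] show "k = l" using n_ge_1 by simp
  qed
  then have "infinite (range (\<lambda>k. P (2 * int n * k) s))"
    using finite_imageD infinite_UNIV_int by blast
  moreover have "range (\<lambda>k. P (2 * int n * k) s) \<subseteq> joined X"
    using s R_shift[OF s(3)] add_multiple_mem_iff unfolding joined_def by blast
  ultimately show ?thesis
    using finite_subset infinite_joined_eqpoll_Compl by blast
qed

text \<open>The shift by one exchanges \<open>X\<close> with its complement, so \<open>P 1\<close>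
  itself is the bijection.\<close>

lemma alternating_joined_eqpoll_Compl:
  assumes alt: "\<And>i. i + 1 \<in> X \<longleftrightarrow> i \<notin> X"
  shows "joined X \<approx> joined (- X)"
proof -
  have alt': "i - 1 \<in> X \<longleftrightarrow> i \<notin> X" for i
    using alt[of "i - 1"] by auto
  have "bij_betw (P 1) (joined X) (joined (- X))"
  proof (rule bij_betw_byWitness[where f' = "P (- 1)"])
    show "\<forall>s\<in>joined X. P (- 1) (P 1 s) = s" using P_minus unfolding joined_def by blast
    show "\<forall>s\<in>joined (- X). P 1 (P (- 1) s) = s" using P_minus[of _ _ _ "- 1"] unfolding joined_def by auto
    show "P 1 ` joined X \<subseteq> joined (- X)"
      unfolding joined_def using alt by (blast intro: R_shift)
    show "P (- 1) ` joined (- X) \<subseteq> joined X"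
    proof safe
      fix s assume "s \<in> joined (- X)"
      then obtain i j where "i \<notin> X" "j \<notin> X" "R i j s" by (auto simp: joined_def)
      then have "i - 1 \<in> X" "j - 1 \<in> X" "R (i - 1) (j - 1) (P (- 1) s)"
        using R_shift[of i j s "- 1"] alt' by auto
      then show "P (- 1) s \<in> joined X" unfolding joined_def by blast
    qed
  qed
  then show ?thesis by (auto simp: eqpoll_def)
qed

text \<open>Double counting of the pairs \<open>(s, k)\<close> with \<open>P k s \<in> joined Y\<close>, for \<open>Y = X\<close> and for
  \<open>Y = - X\<close>; for a fixed \<open>s\<close> the numbers agree by the hexachord theorem.\<close>

lemma determined_joined_eqpoll_Compl:
  assumes determined: "\<And>i j i' j' s. \<lbrakk>R i j s; R i' j' s\<rbrakk> \<Longrightarrow>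
     ({i, j} \<subseteq> X \<longleftrightarrow> {i', j'} \<subseteq> X) \<and> ({i, j} \<subseteq> - X \<longleftrightarrow> {i', j'} \<subseteq> - X)"
  shows "joined X \<approx> joined (- X)"
proof (cases "finite (joined X)")
  case False
  then show ?thesis by (rule infinite_joined_eqpoll_Compl)
next
  case True
  interpret C: balanced_joining "- X" n R P by (rule balanced_joining_Compl)
  let ?W = "joined_shift X" and ?I = "{0..<2 * int n}"
  have fin: "finite ?W" using True by (simp add: finite_joined_shift_iff)
  have fin': "finite (joined (- X))"
    using fin C.finite_joined_shift_iff by (simp add: joined_shift_Compl)
  have count: "2 * n * card (joined Y) = (\<Sum>s\<in>?W. card {k \<in> ?I. P k s \<in> joined Y})"
    if "joined Y \<subseteq> ?W" for Y
  proof -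
    \<comment> \<open>\<open>P k\<close> permutes \<open>?W\<close>, so every \<open>k\<close>
      contributes the same number of pairs.\<close>
    have "card {s \<in> ?W. P k s \<in> joined Y} = card (joined Y)" for k
    proof (rule bij_betw_same_card)
      show "bij_betw (P k) {s \<in> ?W. P k s \<in> joined Y} (joined Y)"
        unfolding bij_betw_def
      proof
        show "inj_on (P k) {s \<in> ?W. P k s \<in> joined Y}"
          by (rule inj_on_subset[OF inj_on_P_joined_shift]) auto
        show "P k ` {s \<in> ?W. P k s \<in> joined Y} = joined Y"
        proof
          show "joined Y \<subseteq> P k ` {s \<in> ?W. P k s \<in> joined Y}"
          proof
            fix s assume s: "s \<in> joined Y"
            with that have "s \<in> P k ` ?W" unfolding P_joined_shift by auto
            with s show "s \<in> P k ` {s \<in> ?W. P k s \<in> joined Y}" by auto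
          qed
        qed auto
      qed
    qed
    then have "2 * n * card (joined Y) = (\<Sum>k\<in>?I. card {s \<in> ?W. P k s \<in> joined Y})"
      by (simp add: nat_mult_distrib)
    also have "\<dots> = (\<Sum>k\<in>?I. \<Sum>s\<in>?W. if P k s \<in> joined Y then 1 else 0)"
      using fin by (simp add: sum.If_cases Int_def)
    also have "\<dots> = (\<Sum>s\<in>?W. \<Sum>k\<in>?I. if P k s \<in> joined Y then 1 else 0)"
      by (rule sum.swap)
    also have "\<dots> = (\<Sum>s\<in>?W. card {k \<in> ?I. P k s \<in> joined Y})"
      by (simp add: sum.If_cases Int_def)
    finally show ?thesis .
  qed
  have "card {k \<in> ?I. P k s \<in> joined X} = card {k \<in> ?I. P k s \<in> joined (- X)}" if s: "s \<in> ?W" for s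
  proof -
    from s obtain p q where pq: "R p q s" by (auto simp: joined_shift_def)
    \<comment> \<open>By \<open>determined\<close>, any one pair of indices of an object decides its
      membership, so the fixed pair \<open>p\<close>, \<open>q\<close> serves for all
      shifts.\<close>
    have *: "P k s \<in> joined Y \<longleftrightarrow> {p + k, q + k} \<subseteq> Y" if Y: "Y = X \<or> Y = - X" for k Y
    proof
      assume "P k s \<in> joined Y"
      then obtain i j where "{i, j} \<subseteq> Y" "R i j (P k s)" by (auto simp: joined_def)
      with determined[OF R_shift[OF pq, of k] this(2)] Y show "{p + k, q + k} \<subseteq> Y" by metis
    qed (use R_shift[OF pq, of k] in \<open>auto simp: joined_def\<close>)
    have "{k \<in> ?I. P k s \<in> joined X} = {k \<in> ?I. p + k \<in> X \<and> q + k \<in> X}"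
      "{k \<in> ?I. P k s \<in> joined (- X)} = {k \<in> ?I. p + k \<notin> X \<and> q + k \<notin> X}"
      using *[of X] *[of "- X"] by simp_all
    then show ?thesis by (simp only: hexachord)
  qed
  then have "(\<Sum>s\<in>?W. card {k \<in> ?I. P k s \<in> joined X}) =
      (\<Sum>s\<in>?W. card {k \<in> ?I. P k s \<in> joined (- X)})"
    by (rule sum.cong[OF refl])
  moreover have "joined (- X) \<subseteq> ?W"
    using joined_subset_joined_shift[of "- X"] by (simp only: joined_shift_Compl)
  ultimately have "2 * n * card (joined X) = 2 * n * card (joined (- X))"
    using count[OF joined_subset_joined_shift] count[of "- X"] by simp
  then have "card (joined X) = card (joined (- X))" using n_ge_1 by simp
  then show ?thesis using True fin' by (simp add: eqpoll_iff_card)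
qed

end

section \<open>Geodesics and isometries of the half-plane\<close>

text \<open>The hyperbolic cosine of the distance as a rational function of the coordinates; it
  turns identities between distances into algebra.\<close>

definition hform :: "complex \<Rightarrow> complex \<Rightarrow> real" where
  "hform z w = ((Re z)\<^sup>2 + (Im z)\<^sup>2 + (Re w)\<^sup>2 + (Im w)\<^sup>2 - 2 * Re z * Re w) / (2 * Im z * Im w)"

lemma hform_eq: "z \<in> H2 \<Longrightarrow> w \<in> H2 \<Longrightarrow> hform z w = 1 + (cmod (z - w))\<^sup>2 / (2 * Im z * Im w)"
  unfolding H2_def hform_def cmod_power2 by (simp add: field_simps power2_eq_square)

lemma hform_ge_1: "z \<in> H2 \<Longrightarrow> w \<in> H2 \<Longrightarrow> 1 \<le> hform z w"
  unfolding hform_eq by (simp add: H2_def)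

lemma cosh_hdist: "z \<in> H2 \<Longrightarrow> w \<in> H2 \<Longrightarrow> cosh (hdist z w) = hform z w"
  using hform_ge_1[of z w] unfolding hdist_def hform_eq[symmetric] by simp

lemma hform_eq_1_iff: "z \<in> H2 \<Longrightarrow> w \<in> H2 \<Longrightarrow> hform z w = 1 \<longleftrightarrow> z = w"
  unfolding hform_eq by (auto simp: H2_def)

lemma hform_same [simp]: "z \<in> H2 \<Longrightarrow> hform z z = 1"
  by (simp add: hform_eq_1_iff)

lemma hisometry_in_H2: "hisometry f \<Longrightarrow> z \<in> H2 \<Longrightarrow> f z \<in> H2"
  by (auto simp: hisometry_def bij_betw_def)

lemma hisometry_hform: "hisometry f \<Longrightarrow> z \<in> H2 \<Longrightarrow> w \<in> H2 \<Longrightarrow> hform (f z) (f w) = hform z w"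
  using cosh_hdist hisometry_in_H2 unfolding hisometry_def by metis

lemma hisometry_inj_on: "hisometry f \<Longrightarrow> inj_on f H2"
  by (simp add: hisometry_def bij_betw_def)

lemma hisometry_image_H2: "hisometry f \<Longrightarrow> f ` H2 = H2"
  by (simp add: hisometry_def bij_betw_def)

lemma unit_speed_geodesic_in_H2: "unit_speed_geodesic c \<Longrightarrow> c t \<in> H2"
  by (simp add: unit_speed_geodesic_def)

lemma unit_speed_geodesic_hform:
  assumes "unit_speed_geodesic c"
  shows "hform (c s) (c t) = cosh (s - t)"
proof -
  have "cosh (hdist (c s) (c t)) = cosh \<bar>s - t\<bar>"
    using assms by (simp add: unit_speed_geodesic_def)
  then show ?thesis
    using assms by (simp add: cosh_hdist unit_speed_geodesic_in_H2)
qed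

lemma unit_speed_geodesic_compose:
  "hisometry f \<Longrightarrow> unit_speed_geodesic c \<Longrightarrow> unit_speed_geodesic (f \<circ> c)"
  by (auto simp: unit_speed_geodesic_def hisometry_in_H2 hisometry_def bij_betw_def)

text \<open>In the following coordinates the half-plane is a sheet of the hyperboloid \<open>\<alpha> \<beta> - \<delta>\<^sup>2 = 1\<close>, and
  \<open>hform\<close> is the polarization of the quadratic form \<open>\<alpha> \<beta> - \<delta>\<^sup>2\<close>.\<close>

definition hcoord_\<alpha> :: "complex \<Rightarrow> real" where "hcoord_\<alpha> z = (cmod z)\<^sup>2 / Im z"
definition hcoord_\<beta> :: "complex \<Rightarrow> real" where "hcoord_\<beta> z = 1 / Im z"
definition hcoord_\<delta> :: "complex \<Rightarrow> real" where "hcoord_\<delta> z = Re z / Im z"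

lemmas hcoord_defs = hcoord_\<alpha>_def hcoord_\<beta>_def hcoord_\<delta>_def

lemma hform_hcoord:
  "z \<in> H2 \<Longrightarrow> w \<in> H2 \<Longrightarrow>
    hform z w = (hcoord_\<alpha> z * hcoord_\<beta> w + hcoord_\<alpha> w * hcoord_\<beta> z) / 2 - hcoord_\<delta> z * hcoord_\<delta> w"
  unfolding H2_def hform_def hcoord_defs cmod_power2 by (simp add: field_simps power2_eq_square)

lemma hcoord_hyperboloid: "z \<in> H2 \<Longrightarrow> hcoord_\<alpha> z * hcoord_\<beta> z = 1 + (hcoord_\<delta> z)\<^sup>2"
  unfolding H2_def hcoord_defs cmod_power2 by (simp add: field_simps power2_eq_square)

lemma hcoord_\<beta>_pos: "z \<in> H2 \<Longrightarrow> 0 < hcoord_\<beta> z"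
  by (simp add: H2_def hcoord_\<beta>_def)

lemma hcoord_inject:
  assumes "z \<in> H2" "w \<in> H2" "hcoord_\<beta> z = hcoord_\<beta> w" "hcoord_\<delta> z = hcoord_\<delta> w"
  shows "z = w"
  using assms by (auto simp: H2_def hcoord_defs complex_eq_iff)

text \<open>Lorentzian geometry in coordinates: the orthogonal complement of a timelike unit vector
  is definite, so it contains no nonzero null vector.\<close>

lemma null_orthogonal_zero:
  fixes \<alpha> \<beta> \<delta> \<alpha>' \<beta>' \<delta>' :: real
  assumes "\<alpha> * \<beta> = \<delta>\<^sup>2" "\<alpha> * \<beta>' + \<alpha>' * \<beta> = 2 * \<delta> * \<delta>'" "\<alpha>' * \<beta>' = 1 + \<delta>'\<^sup>2"
  shows "\<alpha> = 0" "\<beta> = 0" "\<delta> = 0"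
proof -
  have "(\<alpha> * \<beta>' - \<alpha>' * \<beta>)\<^sup>2 = (\<alpha> * \<beta>' + \<alpha>' * \<beta>)\<^sup>2 - 4 * (\<alpha> * \<beta>) * (\<alpha>' * \<beta>')"
    by (simp add: power2_eq_square algebra_simps)
  also have "\<dots> = - 4 * \<delta>\<^sup>2"
    unfolding assms by (simp add: power2_eq_square algebra_simps)
  finally have sq: "(\<alpha> * \<beta>' - \<alpha>' * \<beta>)\<^sup>2 + 4 * \<delta>\<^sup>2 = 0" by simp
  then have "\<delta>\<^sup>2 = 0"
    using zero_le_power2[of "\<alpha> * \<beta>' - \<alpha>' * \<beta>"] zero_le_power2[of \<delta>] by linarith
  then show \<delta>: "\<delta> = 0" by simp
  have "\<alpha>' * \<beta>' > 0" unfolding assms(3) by (rule add_pos_nonneg) auto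
  then have nz: "\<alpha>' \<noteq> 0" "\<beta>' \<noteq> 0" by auto
  from \<delta> assms(2) sq have "\<alpha> * \<beta>' = 0" "\<alpha>' * \<beta> = 0" by auto
  then show "\<alpha> = 0" "\<beta> = 0" using nz by auto
qed

text \<open>The definition of \<open>unit_speed_geodesic\<close> is purely metric, so the formula
  has to come from distances. In the ambient space, the difference between \<open>c t\<close> and
  the expected combination of \<open>c 0\<close> and \<open>c 1\<close> is null and orthogonal to
  \<open>c 0\<close>, hence zero.\<close>

lemma unit_speed_geodesic_coordinates:
  assumes c: "unit_speed_geodesic c"
  obtains A B C D where "\<And>t. 1 / Im (c t) = A * cosh t + B * sinh t"
    "\<And>t. Re (c t) / Im (c t) = C * cosh t + D * sinh t"
proof -
  define \<alpha> where "\<alpha> t = hcoord_\<alpha> (c t)" for t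
  define \<beta> where "\<beta> t = hcoord_\<beta> (c t)" for t
  define \<delta> where "\<delta> t = hcoord_\<delta> (c t)" for t
  have form: "\<alpha> s * \<beta> t + \<alpha> t * \<beta> s = 2 * cosh (s - t) + 2 * (\<delta> s * \<delta> t)" for s t
    using hform_hcoord[of "c s" "c t"] unit_speed_geodesic_hform[OF c, of s t]
      unit_speed_geodesic_in_H2[OF c] unfolding \<alpha>_def \<beta>_def \<delta>_def by (simp add: field_simps)
  have unit: "\<alpha> t * \<beta> t = 1 + (\<delta> t)\<^sup>2" for t
    using hcoord_hyperboloid[OF unit_speed_geodesic_in_H2[OF c]]
    unfolding \<alpha>_def \<beta>_def \<delta>_def by simp
  define s1 where "s1 = sinh (1::real)"
  have s1: "s1 \<noteq> 0" by (simp add: s1_def)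
  have c1: "cosh 1 ^ 2 = 1 + s1\<^sup>2" unfolding s1_def by (simp add: cosh_square_eq)
  have *: "\<beta> t = cosh t * \<beta> 0 + sinh t * ((\<beta> 1 - cosh 1 * \<beta> 0) / s1) \<and>
      \<delta> t = cosh t * \<delta> 0 + sinh t * ((\<delta> 1 - cosh 1 * \<delta> 0) / s1)" for t
  proof -
    \<comment> \<open>\<open>p\<close> and \<open>q\<close> are the coefficients that express a
      combination of \<open>cosh t\<close> and \<open>sinh t\<close> through its values at 0 and
      1.\<close>
    define q where "q = sinh t / s1"
    define p where "p = cosh t - q * cosh 1"
    define x where "x = \<alpha> t - p * \<alpha> 0 - q * \<alpha> 1"
    define y where "y = \<beta> t - p * \<beta> 0 - q * \<beta> 1"
    define z where "z = \<delta> t - p * \<delta> 0 - q * \<delta> 1"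
    have st: "sinh t = q * s1" using s1 by (simp add: q_def)
    have ct: "cosh t ^ 2 = 1 + (q * s1)\<^sup>2" using cosh_square_eq[of t] st by simp
    have ct1: "cosh (t - 1) = cosh t * cosh 1 - q * s1 * s1"
      by (simp add: cosh_diff st s1_def)
    have orth: "x * \<beta> 0 + \<alpha> 0 * y = 2 * z * \<delta> 0"
    proof -
      have "x * \<beta> 0 + \<alpha> 0 * y - 2 * z * \<delta> 0 = (\<alpha> t * \<beta> 0 + \<alpha> 0 * \<beta> t - 2 * (\<delta> t * \<delta> 0))
          - p * 2 * (\<alpha> 0 * \<beta> 0 - (\<delta> 0)\<^sup>2) - q * (\<alpha> 1 * \<beta> 0 + \<alpha> 0 * \<beta> 1 - 2 * (\<delta> 1 * \<delta> 0))"
        unfolding x_def y_def z_def by (simp add: power2_eq_square algebra_simps)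
      also have "\<dots> = 2 * cosh t - p * 2 - q * (2 * cosh 1)"
        using form[of t 0] unit[of 0] form[of 1 0] by simp
      also have "\<dots> = 0" by (simp add: p_def)
      finally show ?thesis by simp
    qed
    have null: "x * y = z\<^sup>2"
    proof -
      have "2 * (x * y - z\<^sup>2) = 2 * (\<alpha> t * \<beta> t - (\<delta> t)\<^sup>2) + p\<^sup>2 * 2 * (\<alpha> 0 * \<beta> 0 - (\<delta> 0)\<^sup>2)
          + q\<^sup>2 * 2 * (\<alpha> 1 * \<beta> 1 - (\<delta> 1)\<^sup>2)
          - 2 * p * (\<alpha> t * \<beta> 0 + \<alpha> 0 * \<beta> t - 2 * (\<delta> t * \<delta> 0))
          - 2 * q * (\<alpha> t * \<beta> 1 + \<alpha> 1 * \<beta> t - 2 * (\<delta> t * \<delta> 1))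
          + 2 * p * q * (\<alpha> 1 * \<beta> 0 + \<alpha> 0 * \<beta> 1 - 2 * (\<delta> 1 * \<delta> 0))"
        unfolding x_def y_def z_def by (simp add: power2_eq_square algebra_simps)
      also have "\<dots> = 2 + p\<^sup>2 * 2 + q\<^sup>2 * 2 - 2 * p * (2 * cosh t) - 2 * q * (2 * cosh (t - 1))
          + 2 * p * q * (2 * cosh 1)"
        using form[of t 0] form[of 1 0] form[of t 1] unit[of 0] unit[of 1] unit[of t] by simp
      also have "\<dots> = 2 - 2 * cosh t ^ 2 + 2 * q\<^sup>2 - 2 * q\<^sup>2 * cosh 1 ^ 2 + 4 * q\<^sup>2 * s1\<^sup>2"
        unfolding ct1 p_def by (simp add: power2_eq_square algebra_simps)
      also have "\<dots> = 0"
        unfolding ct c1 by (simp add: power2_eq_square algebra_simps)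
      finally show ?thesis by simp
    qed
    from null_orthogonal_zero[OF null orth unit] have "y = 0" "z = 0" by auto
    then have "\<beta> t = p * \<beta> 0 + q * \<beta> 1" "\<delta> t = p * \<delta> 0 + q * \<delta> 1"
      by (simp_all add: y_def z_def)
    moreover have "p * a + q * b = cosh t * a + sinh t * ((b - cosh 1 * a) / s1)" for a b
      using s1 unfolding p_def q_def by (simp add: field_simps)
    ultimately show ?thesis by simp
  qed
  show thesis
  proof (rule that)
    fix t
    show "1 / Im (c t) = \<beta> 0 * cosh t + ((\<beta> 1 - cosh 1 * \<beta> 0) / s1) * sinh t"
      using conjunct1[OF *[of t]] unfolding \<beta>_def[of t] hcoord_\<beta>_def by (simp only: mult.commute)
    show "Re (c t) / Im (c t) = \<delta> 0 * cosh t + ((\<delta> 1 - cosh 1 * \<delta> 0) / s1) * sinh t"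
      using conjunct2[OF *[of t]] unfolding \<delta>_def[of t] hcoord_\<delta>_def by (simp only: mult.commute)
  qed
qed

text \<open>The coordinate formulas exhibit both parts of \<open>c\<close> as quotients of smooth
  functions with the nonzero denominator \<open>1 / Im (c t)\<close>.\<close>

lemma unit_speed_geodesic_differentiable:
  assumes c: "unit_speed_geodesic c"
  shows "\<exists>u. (c has_vector_derivative u) (at t)"
proof -
  obtain A B C D where b: "\<And>t. 1 / Im (c t) = A * cosh t + B * sinh t"
    and d: "\<And>t. Re (c t) / Im (c t) = C * cosh t + D * sinh t"
    using unit_speed_geodesic_coordinates[OF c] by blast
  have pos: "Im (c t) > 0" for t using unit_speed_geodesic_in_H2[OF c] by (simp add: H2_def)
  have nz: "A * cosh t + B * sinh t \<noteq> 0" for t using pos[of t] b[of t, symmetric] by simp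
  have Im: "Im (c t) = 1 / (A * cosh t + B * sinh t)" for t using b[of t, symmetric] by simp
  have "Re (c t) = (Re (c t) / Im (c t)) * Im (c t)" for t using pos[of t] by simp
  then have Re: "Re (c t) = (C * cosh t + D * sinh t) / (A * cosh t + B * sinh t)" for t
    unfolding d unfolding Im by simp
  have "\<exists>x. ((\<lambda>t. Re (c t)) has_real_derivative x) (at t)"
    unfolding Re by (rule exI) (rule derivative_eq_intros refl nz)+
  moreover have "\<exists>y. ((\<lambda>t. Im (c t)) has_real_derivative y) (at t)"
    unfolding Im by (rule exI) (rule derivative_eq_intros refl nz)+
  ultimately obtain x y where "((\<lambda>t. Re (c t)) has_real_derivative x) (at t)"
    "((\<lambda>t. Im (c t)) has_real_derivative y) (at t)" by blast
  then have "(c has_vector_derivative Complex x y) (at t)"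
    unfolding has_vector_derivative_complex_iff by simp
  then show ?thesis by blast
qed

section \<open>Infinitesimal distances and conformality of isometries\<close>

text \<open>The second-order expansion of the form along two curves through \<open>p\<close>. It
  recovers the Riemannian length of the difference of the velocities from distances alone.\<close>

lemma hform_tendsto:
  assumes "(c has_vector_derivative u) (at t)" "(d has_vector_derivative v) (at t')"
    and "c t = p" "d t' = p" and "\<And>s. c s \<in> H2" "\<And>s. d s \<in> H2"
  shows "((\<lambda>h. (hform (c (t + h)) (d (t' + h)) - 1) / h\<^sup>2) \<longlongrightarrow> (cmod (u - v))\<^sup>2 / (2 * (Im p)\<^sup>2)) (at 0)"
proof -
  have quot: "((\<lambda>h. (f (a + h) - f a) /\<^sub>R h) \<longlongrightarrow> w) (at 0)" if "(f has_vector_derivative w) (at a)"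
    for f :: "real \<Rightarrow> complex" and a w
  proof -
    have "((\<lambda>h. norm (f (a + h) - f a - h *\<^sub>R w) / norm h) \<longlongrightarrow> 0) (at 0)"
      using that unfolding has_vector_derivative_def has_derivative_at by blast
    moreover have "\<forall>\<^sub>F h in at 0. norm (f (a + h) - f a - h *\<^sub>R w) / norm h
        = norm ((f (a + h) - f a) /\<^sub>R h - w)"
    proof (rule eventually_at_filter[THEN iffD2], rule always_eventually, intro allI impI)
      fix h :: real assume "h \<noteq> 0"
      then have "(f (a + h) - f a) /\<^sub>R h - w = (f (a + h) - f a - h *\<^sub>R w) /\<^sub>R h"
        by (simp add: scaleR_diff_right)
      then show "norm (f (a + h) - f a - h *\<^sub>R w) / norm h = norm ((f (a + h) - f a) /\<^sub>R h - w)"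
        by (simp add: divide_inverse mult.commute)
    qed
    ultimately have "((\<lambda>h. norm ((f (a + h) - f a) /\<^sub>R h - w)) \<longlongrightarrow> 0) (at 0)"
      by (rule Lim_transform_eventually)
    then show ?thesis by (simp add: tendsto_norm_zero_iff LIM_zero_iff)
  qed
  have cont: "((\<lambda>h. f (a + h)) \<longlongrightarrow> f a) (at 0)" if "(f has_vector_derivative w) (at a)"
    for f :: "real \<Rightarrow> complex" and a w
    using has_vector_derivative_continuous[OF that] by (intro LIM_offset_zero) (simp add: continuous_at)
  have "((\<lambda>h. (cmod ((c (t + h) - c t) /\<^sub>R h - (d (t' + h) - d t') /\<^sub>R h))\<^sup>2 /
      (2 * Im (c (t + h)) * Im (d (t' + h)))) \<longlongrightarrow> (cmod (u - v))\<^sup>2 / (2 * Im p * Im p)) (at 0)"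
    by (intro tendsto_intros quot assms cont[OF assms(1), unfolded assms] cont[OF assms(2), unfolded assms])
      (use assms(3,4) assms(5)[of t] in \<open>auto simp: H2_def\<close>)
  \<comment> \<open>This includes \<open>h = 0\<close>, where both sides are 0 because division by
    zero gives 0.\<close>
  moreover have "(cmod ((c (t + h) - c t) /\<^sub>R h - (d (t' + h) - d t') /\<^sub>R h))\<^sup>2 /
      (2 * Im (c (t + h)) * Im (d (t' + h))) = (hform (c (t + h)) (d (t' + h)) - 1) / h\<^sup>2" for h
  proof -
    have quot_diff: "(c (t + h) - c t) /\<^sub>R h - (d (t' + h) - d t') /\<^sub>R h = (c (t + h) - d (t' + h)) /\<^sub>R h"
      unfolding assms(3,4) by (simp add: scaleR_diff_right)
    have inv: "\<bar>inverse h\<bar>\<^sup>2 = inverse (h\<^sup>2)" by (simp only: power2_abs power_inverse)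
    from quot_diff have eq: "cmod ((c (t + h) - c t) /\<^sub>R h - (d (t' + h) - d t') /\<^sub>R h) =
        \<bar>inverse h\<bar> * cmod (c (t + h) - d (t' + h))"
      by (simp only: norm_scaleR)
    show ?thesis
      unfolding eq hform_eq[OF assms(5,6)] power_mult_distrib inv
      by (simp only: divide_inverse add_diff_cancel_left' mult_ac)
  qed
  ultimately show ?thesis by (simp add: power2_eq_square mult.assoc)
qed

text \<open>The limit in \<open>hform_tendsto\<close> is the same for two curves and for their
  images. Comparing \<open>c\<close> with \<open>d\<close>, and each of them with a constant curve,
  gives three norms, and polarization gives the inner product. The map \<open>f\<close> is
  differentiated only along the two curves.\<close>

lemma hisometry_conformal:
  assumes f: "hisometry f" and "\<And>s. c s \<in> H2" "\<And>s. d s \<in> H2" and "d t' = c t"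
    and "(c has_vector_derivative u) (at t)" "(d has_vector_derivative v) (at t')"
    and "(f \<circ> c has_vector_derivative u') (at t)" "(f \<circ> d has_vector_derivative v') (at t')"
    and "u \<bullet> v = 0"
  shows "u' \<bullet> v' = 0"
proof -
  let ?p = "c t"
  have in_H2: "(f \<circ> c) s \<in> H2" "(f \<circ> d) s \<in> H2" for s
    using assms hisometry_in_H2[OF f] by auto
  have pos: "Im ?p > 0" "Im (f ?p) > 0"
    using assms(2)[of t] in_H2(1)[of t] by (auto simp: H2_def)
  have *: "(cmod (x - y))\<^sup>2 / (Im ?p)\<^sup>2 = (cmod (x' - y'))\<^sup>2 / (Im (f ?p))\<^sup>2"
    if "(a has_vector_derivative x) (at r)" "(b has_vector_derivative y) (at r')"
      "(f \<circ> a has_vector_derivative x') (at r)" "(f \<circ> b has_vector_derivative y') (at r')"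
      "a r = ?p" "b r' = ?p" "\<And>s. a s \<in> H2" "\<And>s. b s \<in> H2"
    for a b :: "real \<Rightarrow> complex" and x y x' y' r r'
  proof -
    have "((\<lambda>h. (hform ((f \<circ> a) (r + h)) ((f \<circ> b) (r' + h)) - 1) / h\<^sup>2)
        \<longlongrightarrow> (cmod (x' - y'))\<^sup>2 / (2 * (Im (f ?p))\<^sup>2)) (at 0)"
      by (rule hform_tendsto[OF that(3,4)]) (use that hisometry_in_H2[OF f] in auto)
    moreover have "((\<lambda>h. (hform (a (r + h)) (b (r' + h)) - 1) / h\<^sup>2)
        \<longlongrightarrow> (cmod (x - y))\<^sup>2 / (2 * (Im ?p)\<^sup>2)) (at 0)"
      by (rule hform_tendsto) (use that in auto)
    moreover have "hform ((f \<circ> a) s) ((f \<circ> b) s') = hform (a s) (b s')" for s s'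
      using that(7,8) by (simp add: hisometry_hform[OF f])
    ultimately have "(cmod (x' - y'))\<^sup>2 / (2 * (Im (f ?p))\<^sup>2) = (cmod (x - y))\<^sup>2 / (2 * (Im ?p)\<^sup>2)"
      by (auto intro: tendsto_unique[OF at_neq_bot])
    then show ?thesis by simp
  qed
  have const: "((\<lambda>s. ?p) has_vector_derivative 0) (at t)" "(f \<circ> (\<lambda>s. ?p) has_vector_derivative 0) (at t)"
    by (simp_all add: o_def)
  have uv: "(cmod (u - v))\<^sup>2 / (Im ?p)\<^sup>2 = (cmod (u' - v'))\<^sup>2 / (Im (f ?p))\<^sup>2"
    by (rule *[OF assms(5-8)]) (use assms in auto)
  have u: "(cmod (u - 0))\<^sup>2 / (Im ?p)\<^sup>2 = (cmod (u' - 0))\<^sup>2 / (Im (f ?p))\<^sup>2"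
    by (rule *[OF assms(5) const(1) assms(7) const(2)]) (use assms in auto)
  have v: "(cmod (v - 0))\<^sup>2 / (Im ?p)\<^sup>2 = (cmod (v' - 0))\<^sup>2 / (Im (f ?p))\<^sup>2"
    by (rule *[OF assms(6) const(1) assms(8) const(2)]) (use assms in auto)
  have polar: "2 * (x \<bullet> y) / r = (cmod x)\<^sup>2 / r + (cmod y)\<^sup>2 / r - (cmod (x - y))\<^sup>2 / r"
    for x y :: complex and r
    by (simp add: power2_norm_eq_inner inner_diff inner_commute diff_divide_distrib add_divide_distrib)
  have "2 * (u' \<bullet> v') / (Im (f ?p))\<^sup>2 = 2 * (u \<bullet> v) / (Im ?p)\<^sup>2"
    unfolding polar using u v uv by simp
  then show ?thesis using \<open>u \<bullet> v = 0\<close> pos by simp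
qed

text \<open>The image curves are again unit-speed geodesics, so their derivatives exist.\<close>

lemma hisometry_meets_orthogonally:
  assumes f: "hisometry f" and c: "unit_speed_geodesic c" and m: "meets_orthogonally c t a"
  shows "meets_orthogonally (f \<circ> c) t (f ` a)"
proof -
  from m obtain d t' u v where d: "unit_speed_geodesic d" "range d = a" "d t' = c t"
    and uv: "(c has_vector_derivative u) (at t)" "(d has_vector_derivative v) (at t')" "u \<bullet> v = 0"
    unfolding meets_orthogonally_def by blast
  have fcd: "unit_speed_geodesic (f \<circ> c)" "unit_speed_geodesic (f \<circ> d)"
    using f c d by (auto intro: unit_speed_geodesic_compose)
  from unit_speed_geodesic_differentiable[OF fcd(1)] unit_speed_geodesic_differentiable[OF fcd(2)]
  obtain u' v' where u'v': "(f \<circ> c has_vector_derivative u') (at t)" "(f \<circ> d has_vector_derivative v') (at t')"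
    by blast
  have "u' \<bullet> v' = 0"
    by (rule hisometry_conformal[OF f _ _ d(3) uv(1,2) u'v' uv(3)])
      (use c d unit_speed_geodesic_in_H2 in auto)
  moreover have "range (f \<circ> d) = f ` a" "(f \<circ> d) t' = (f \<circ> c) t" using d by auto
  ultimately show ?thesis
    using fcd u'v' unfolding meets_orthogonally_def by blast
qed

lemma hisometry_ortho_segment:
  assumes f: "hisometry f" and "ortho_segment s L a b"
  shows "ortho_segment (f ` s) L (f ` a) (f ` b)"
proof -
  from assms(2) obtain c where "unit_speed_geodesic c" "0 < L" "s = c ` {0..L}"
    "meets_orthogonally c 0 a" "meets_orthogonally c L b"
    unfolding ortho_segment_def by blast
  then have "unit_speed_geodesic (f \<circ> c)" "0 < L" "f ` s = (f \<circ> c) ` {0..L}"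
    "meets_orthogonally (f \<circ> c) 0 (f ` a)" "meets_orthogonally (f \<circ> c) L (f ` b)"
    using f by (auto intro: unit_speed_geodesic_compose hisometry_meets_orthogonally simp: image_comp)
  then show ?thesis unfolding ortho_segment_def by blast
qed

section \<open>Powers and fixed points of isometries\<close>

lemma hisometry_id: "hisometry id"
  by (simp add: hisometry_def)

lemma hisometry_compose: "hisometry f \<Longrightarrow> hisometry h \<Longrightarrow> hisometry (f \<circ> h)"
  using bij_betw_trans[of h H2 H2 f H2] by (auto simp: hisometry_def hisometry_in_H2 bij_betw_def)

lemma hisometry_inv_into:
  assumes f: "hisometry f"
  shows "hisometry (inv_into H2 f)"
  unfolding hisometry_def
proof (intro conjI ballI)
  show bij: "bij_betw (inv_into H2 f) H2 H2"
    using f by (simp add: hisometry_def bij_betw_inv_into)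
  fix z w assume "z \<in> H2" "w \<in> H2"
  moreover from this have "inv_into H2 f z \<in> H2" "inv_into H2 f w \<in> H2"
    using bij by (auto simp: bij_betw_def)
  ultimately show "hdist (inv_into H2 f z) (inv_into H2 f w) = hdist z w"
    using f hisometry_image_H2[OF f] unfolding hisometry_def by (metis f_inv_into_f)
qed

lemma hisometry_funpow: "hisometry f \<Longrightarrow> hisometry (f ^^ k)"
  by (induction k) (auto simp: hisometry_id hisometry_compose simp flip: id_def)

lemma hisometry_iso_pow: "hisometry f \<Longrightarrow> hisometry (iso_pow f i)"
  by (auto simp: iso_pow_def intro: hisometry_funpow hisometry_inv_into)

lemma iso_pow_0 [simp]: "iso_pow f 0 z = z"
  by (simp add: iso_pow_def)

lemma iso_pow_int: "iso_pow f (int k) = f ^^ k"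
  by (simp add: iso_pow_def)

lemma iso_pow_1 [simp]: "iso_pow f 1 z = f z"
  by (simp add: iso_pow_def)

lemma iso_pow_in_H2: "hisometry f \<Longrightarrow> z \<in> H2 \<Longrightarrow> iso_pow f i z \<in> H2"
  by (simp add: hisometry_iso_pow hisometry_in_H2)

lemma iso_pow_Suc:
  assumes f: "hisometry f" and z: "z \<in> H2"
  shows "iso_pow f (i + 1) z = f (iso_pow f i z)"
proof (cases "0 \<le> i")
  case True
  then have "nat (i + 1) = Suc (nat i)" by simp
  with True show ?thesis by (simp add: iso_pow_def)
next
  case False
  \<comment> \<open>One inverse is split off to cancel against \<open>f\<close>; \<open>k\<close>
    counts the others. For \<open>i = - 1\<close> the exponent \<open>i + 1\<close> falls into the
    other branch of \<open>iso_pow\<close>.\<close>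
  define k where "k = nat (- i - 1)"
  let ?h = "inv_into H2 f"
  have "(?h ^^ k) z \<in> H2"
    using hisometry_funpow[OF hisometry_inv_into[OF f]] z by (rule hisometry_in_H2)
  then have "f (?h ((?h ^^ k) z)) = (?h ^^ k) z"
    using hisometry_image_H2[OF f] by (simp add: f_inv_into_f)
  moreover have "iso_pow f i z = ?h ((?h ^^ k) z)"
  proof -
    have "nat (- i) = Suc k" using False by (simp add: k_def)
    with False show ?thesis by (simp add: iso_pow_def)
  qed
  moreover have "iso_pow f (i + 1) z = (?h ^^ k) z"
  proof (cases "i = - 1")
    case False
    with \<open>\<not> 0 \<le> i\<close> have "\<not> 0 \<le> i + 1" "nat (- (i + 1)) = k" by (simp_all add: k_def)
    then show ?thesis by (simp add: iso_pow_def)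
  qed (simp add: k_def)
  ultimately show ?thesis by simp
qed

lemma iso_pow_add:
  assumes f: "hisometry f" and z: "z \<in> H2"
  shows "iso_pow f (i + j) z = iso_pow f i (iso_pow f j z)"
proof (induction i rule: int_induct[where k = 0])
  case base
  show ?case by simp
next
  case (step1 i)
  have "iso_pow f (i + 1 + j) z = f (iso_pow f (i + j) z)"
    using iso_pow_Suc[OF f z, of "i + j"] by (simp add: add_ac)
  also have "\<dots> = iso_pow f (i + 1) (iso_pow f j z)"
    using step1 iso_pow_Suc[OF f iso_pow_in_H2[OF f z]] by simp
  finally show ?case .
next
  case (step2 i)
  have "f (iso_pow f (i - 1 + j) z) = iso_pow f (i + j) z"
    using iso_pow_Suc[OF f z, of "i - 1 + j"] by (simp add: algebra_simps)
  also have "\<dots> = f (iso_pow f (i - 1) (iso_pow f j z))"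
    using step2 iso_pow_Suc[OF f iso_pow_in_H2[OF f z], of "i - 1" j] by simp
  finally show ?case
    using inj_onD[OF hisometry_inj_on[OF f]] iso_pow_in_H2[OF f] z by blast
qed

lemma iso_pow_image_add:
  assumes "hisometry f" "S \<subseteq> H2"
  shows "iso_pow f i ` iso_pow f j ` S = iso_pow f (i + j) ` S"
  unfolding image_image using assms iso_pow_add by (intro image_cong) (auto simp: subset_iff)

lemma iso_pow_minus:
  "hisometry f \<Longrightarrow> z \<in> H2 \<Longrightarrow> iso_pow f (- i) (iso_pow f i z) = z"
  using iso_pow_add[of f z "- i" i] by simp

text \<open>Two points at equal distances from two given points differ, in the coordinates of the
  hyperboloid, by a vector orthogonal to a plane; so the possible points lie on a line, and a line
  meets the hyperboloid in at most two points.\<close>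

lemma hform_two_solutions:
  assumes H2: "p \<in> H2" "q \<in> H2" "x \<in> H2" "y \<in> H2" "z \<in> H2" and "p \<noteq> q"
    and p: "hform p x = hform p y" "hform p x = hform p z"
    and q: "hform q x = hform q y" "hform q x = hform q z"
    and "x \<noteq> y" "x \<noteq> z"
  shows "y = z"
proof -
  define a1 b1 d1 where "a1 = hcoord_\<alpha> x - hcoord_\<alpha> y" and "b1 = hcoord_\<beta> x - hcoord_\<beta> y"
    and "d1 = hcoord_\<delta> x - hcoord_\<delta> y"
  define a2 b2 d2 where "a2 = hcoord_\<alpha> x - hcoord_\<alpha> z" and "b2 = hcoord_\<beta> x - hcoord_\<beta> z"
    and "d2 = hcoord_\<delta> x - hcoord_\<delta> z"
  have eq1: "hcoord_\<beta> r * a1 = 2 * hcoord_\<delta> r * d1 - hcoord_\<alpha> r * b1"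
    if "r \<in> H2" "hform r x = hform r y" for r
    using that(2) unfolding hform_hcoord[OF that(1) H2(3)] hform_hcoord[OF that(1) H2(4)]
      a1_def b1_def d1_def by (simp add: field_simps)
  have eq2: "hcoord_\<beta> r * a2 = 2 * hcoord_\<delta> r * d2 - hcoord_\<alpha> r * b2"
    if "r \<in> H2" "hform r x = hform r z" for r
    using that(2) unfolding hform_hcoord[OF that(1) H2(3)] hform_hcoord[OF that(1) H2(5)]
      a2_def b2_def d2_def by (simp add: field_simps)
  \<comment> \<open>The first component of the vector product of the two differences. By
    \<open>w2\<close> and \<open>w3\<close> this product is proportional to the dual vectors of
    \<open>p\<close> and of \<open>q\<close>; were it nonzero, \<open>p\<close> and \<open>q\<close>
    would coincide. Hence it vanishes and the differences are parallel.\<close>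
  define w1 where "w1 = b1 * d2 - d1 * b2"
  have w2: "hcoord_\<beta> r * (d1 * a2 - a1 * d2) = hcoord_\<alpha> r * w1"
    and w3: "hcoord_\<beta> r * (a1 * b2 - b1 * a2) = - 2 * hcoord_\<delta> r * w1"
    if "r \<in> H2" "hform r x = hform r y" "hform r x = hform r z" for r
  proof -
    have "hcoord_\<beta> r * (d1 * a2 - a1 * d2) = d1 * (hcoord_\<beta> r * a2) - (hcoord_\<beta> r * a1) * d2"
      by (simp add: algebra_simps)
    then show "hcoord_\<beta> r * (d1 * a2 - a1 * d2) = hcoord_\<alpha> r * w1"
      unfolding eq1[OF that(1,2)] eq2[OF that(1,3)] w1_def by (simp add: algebra_simps)
    have "hcoord_\<beta> r * (a1 * b2 - b1 * a2) = (hcoord_\<beta> r * a1) * b2 - b1 * (hcoord_\<beta> r * a2)"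
      by (simp add: algebra_simps)
    then show "hcoord_\<beta> r * (a1 * b2 - b1 * a2) = - 2 * hcoord_\<delta> r * w1"
      unfolding eq1[OF that(1,2)] eq2[OF that(1,3)] w1_def by (simp add: algebra_simps)
  qed
  have pos: "hcoord_\<beta> p > 0" "hcoord_\<beta> q > 0" using H2 by (simp_all add: hcoord_\<beta>_pos)
  have "w1 = 0"
  proof (rule ccontr)
    assume w1: "w1 \<noteq> 0"
    have "hcoord_\<beta> q * (hcoord_\<alpha> p * w1) = hcoord_\<beta> p * (hcoord_\<alpha> q * w1)"
      using w2[OF H2(1) p] w2[OF H2(2) q] by (metis mult.left_commute)
    then have "hcoord_\<beta> q * hcoord_\<alpha> p = hcoord_\<beta> p * hcoord_\<alpha> q" using w1 by simp
    then have cmod: "(cmod p)\<^sup>2 = (cmod q)\<^sup>2" using H2 by (simp add: hcoord_defs H2_def mult.commute)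
    have "hcoord_\<beta> q * (- 2 * hcoord_\<delta> p * w1) = hcoord_\<beta> p * (- 2 * hcoord_\<delta> q * w1)"
      using w3[OF H2(1) p] w3[OF H2(2) q] by (metis mult.left_commute)
    then have "hcoord_\<beta> q * hcoord_\<delta> p = hcoord_\<beta> p * hcoord_\<delta> q" using w1 by simp
    then have "Re p = Re q" using H2 by (simp add: hcoord_defs H2_def mult.commute)
    with cmod have "Im p = Im q" using H2 by (simp add: cmod_power2 H2_def power2_eq_iff)
    with \<open>Re p = Re q\<close> \<open>p \<noteq> q\<close> show False by (simp add: complex_eq_iff)
  qed
  then have par: "b1 * d2 = d1 * b2" "d1 * a2 = a1 * d2" "a1 * b2 = b1 * a2"
    using w2[OF H2(1) p] w3[OF H2(1) p] pos by (simp_all add: w1_def)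
  have "b1 \<noteq> 0 \<or> d1 \<noteq> 0"
    using hcoord_inject[OF H2(3,4)] \<open>x \<noteq> y\<close> unfolding b1_def d1_def by auto
  have "\<exists>l. b2 = l * b1 \<and> d2 = l * d1 \<and> a2 = l * a1"
  proof (cases "b1 = 0")
    case True
    then have "d1 \<noteq> 0" using \<open>b1 \<noteq> 0 \<or> d1 \<noteq> 0\<close> by simp
    then show ?thesis using par True by (intro exI[of _ "d2 / d1"]) (auto simp: field_simps)
  next
    case False
    then show ?thesis using par by (intro exI[of _ "b2 / b1"]) (auto simp: field_simps)
  qed
  then obtain l where l: "b2 = l * b1" "d2 = l * d1" "a2 = l * a1" by blast
  \<comment> \<open>The points \<open>x\<close>, \<open>y\<close>, \<open>z\<close> have parameters
    0, 1, \<open>l\<close> on one line, and the hyperboloid imposes the quadratic equation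
    \<open>l * l * N = l * M\<close> on the parameter. The direction of the line is orthogonal to
    the timelike \<open>p\<close>, so \<open>N\<close> cannot vanish.\<close>
  define N where "N = a1 * b1 - d1\<^sup>2"
  define M where "M = hcoord_\<alpha> x * b1 + a1 * hcoord_\<beta> x - 2 * hcoord_\<delta> x * d1"
  have "(hcoord_\<alpha> x - a1) * (hcoord_\<beta> x - b1) = 1 + (hcoord_\<delta> x - d1)\<^sup>2"
    using hcoord_hyperboloid[OF H2(4)] by (simp add: a1_def b1_def d1_def)
  then have 1: "N = M"
    using hcoord_hyperboloid[OF H2(3)] unfolding N_def M_def by (simp add: algebra_simps power2_eq_square)
  have "(hcoord_\<alpha> x - l * a1) * (hcoord_\<beta> x - l * b1) = 1 + (hcoord_\<delta> x - l * d1)\<^sup>2"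
    using hcoord_hyperboloid[OF H2(5)] unfolding l[symmetric] by (simp add: a2_def b2_def d2_def)
  then have 2: "l * l * N = l * M"
    using hcoord_hyperboloid[OF H2(3)] unfolding N_def M_def by (simp add: algebra_simps power2_eq_square)
  have "N \<noteq> 0"
  proof
    assume "N = 0"
    then have null: "a1 * b1 = d1\<^sup>2" by (simp add: N_def)
    have orth: "a1 * hcoord_\<beta> p + hcoord_\<alpha> p * b1 = 2 * d1 * hcoord_\<delta> p"
      using eq1[OF H2(1) p(1)] by (simp add: algebra_simps)
    from null_orthogonal_zero[OF null orth hcoord_hyperboloid[OF H2(1)]]
    show False using \<open>b1 \<noteq> 0 \<or> d1 \<noteq> 0\<close> by auto
  qed
  with 1 2 have "l = 0 \<or> l = 1" by auto
  moreover have "l \<noteq> 0"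
    using hcoord_inject[OF H2(3,5)] \<open>x \<noteq> z\<close> l unfolding b2_def d2_def by auto
  ultimately have "b2 = b1" "d2 = d1" using l by auto
  then show ?thesis
    using hcoord_inject[OF H2(4,5)] unfolding b1_def b2_def d1_def d2_def by auto
qed

text \<open>The points \<open>z\<close>, \<open>f z\<close> and \<open>f (f z)\<close> have the same
  distances from \<open>p\<close> and \<open>q\<close>, but at most two points do.\<close>

lemma hisometry_fixes_two:
  assumes f: "hisometry f" and "p \<in> H2" "q \<in> H2" "p \<noteq> q" "f p = p" "f q = q" and z: "z \<in> H2"
  shows "f (f z) = z"
proof (rule ccontr)
  assume "f (f z) \<noteq> z"
  then have "f z \<noteq> z" "f (f z) \<noteq> f z"
    using inj_onD[OF hisometry_inj_on[OF f]] hisometry_in_H2[OF f] z by metis+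
  have *: "hform r (f x) = hform r x" if "r \<in> H2" "f r = r" "x \<in> H2" for r x
    using hisometry_hform[OF f that(1,3)] that(2) by simp
  have "f z = f (f z)"
  proof (rule hform_two_solutions[OF assms(2,3) z _ _ assms(4)])
    show "f z \<in> H2" "f (f z) \<in> H2" using hisometry_in_H2[OF f] z by auto
  qed (use * assms hisometry_in_H2[OF f] \<open>f z \<noteq> z\<close> \<open>f (f z) \<noteq> z\<close> in auto)
  with \<open>f (f z) \<noteq> f z\<close> show False by simp
qed

text \<open>The projection of the hyperboloid along the axis through \<open>w\<close>.\<close>

definition hdisc :: "complex \<Rightarrow> complex \<Rightarrow> complex" where
  "hdisc w z = (let z' = Complex ((Re z - Re w) / Im w) (Im z / Im w)
     in Complex ((hcoord_\<alpha> z' - hcoord_\<beta> z') / 2) (hcoord_\<delta> z'))"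

text \<open>Splits the form into the part along the axis, on which \<open>z\<close> has the
  coordinate \<open>hform w z\<close>, and a Euclidean part on the projections.\<close>

lemma hform_hdisc:
  assumes "w \<in> H2" "z \<in> H2" "z' \<in> H2"
  shows "hform z z' = hform w z * hform w z' - hdisc w z \<bullet> hdisc w z'"
proof -
  \<comment> \<open>The isometry normalizing \<open>w\<close> to \<open>\<i>\<close>, whose axis
    coordinate is half the sum of \<open>hcoord_\<alpha>\<close> and
    \<open>hcoord_\<beta>\<close>.\<close>
  define T where "T z = Complex ((Re z - Re w) / Im w) (Im z / Im w)" for z
  have T_H2: "T z \<in> H2" if "z \<in> H2" for z using that assms(1) by (simp add: T_def H2_def)
  have T: "hform (T z) (T z') = hform z z'" if "z \<in> H2" "z' \<in> H2" for z z'
    using that assms(1) unfolding hform_def T_def H2_def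
    by (simp add: field_simps power2_eq_square)
  have Tw: "T w = \<i>" using assms(1) by (simp add: T_def H2_def complex_eq_iff)
  have i: "\<i> \<in> H2" "hcoord_\<alpha> \<i> = 1" "hcoord_\<beta> \<i> = 1" "hcoord_\<delta> \<i> = 0"
    by (simp_all add: H2_def hcoord_defs)
  have *: "hform w z = (hcoord_\<alpha> (T z) + hcoord_\<beta> (T z)) / 2" if "z \<in> H2" for z
    using T[OF assms(1) that] hform_hcoord[OF i(1) T_H2[OF that]] by (simp add: Tw i add.commute)
  have "hform z z' = (hcoord_\<alpha> (T z) * hcoord_\<beta> (T z') + hcoord_\<alpha> (T z') * hcoord_\<beta> (T z)) / 2
      - hcoord_\<delta> (T z) * hcoord_\<delta> (T z')"
    using T[OF assms(2,3)] hform_hcoord[OF T_H2[OF assms(2)] T_H2[OF assms(3)]] by simp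
  then show ?thesis
    unfolding *[OF assms(2)] *[OF assms(3)] hdisc_def Let_def T_def[symmetric] inner_complex_def
    by (simp add: field_simps)
qed

lemma norm_hdisc: "w \<in> H2 \<Longrightarrow> z \<in> H2 \<Longrightarrow> (cmod (hdisc w z))\<^sup>2 = (hform w z)\<^sup>2 - 1"
  using hform_hdisc[of w z z] by (simp add: power2_norm_eq_inner power2_eq_square[of "hform w z"])

lemma hdisc_inject:
  assumes "w \<in> H2" "z \<in> H2" "z' \<in> H2" "hdisc w z = hdisc w z'"
  shows "z = z'"
proof -
  have "(hform w z)\<^sup>2 = (hform w z')\<^sup>2"
    using norm_hdisc[OF assms(1,2)] norm_hdisc[OF assms(1,3)] assms(4) by simp
  then have "hform w z = hform w z'"
    using hform_ge_1[OF assms(1,2)] hform_ge_1[OF assms(1,3)] by (simp add: power2_eq_iff_nonneg)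
  then have "hform z z' = hform z z"
    using hform_hdisc[OF assms(1-3)] hform_hdisc[OF assms(1,2,2)] assms(4) by simp
  then show ?thesis using assms(2,3) by (simp add: hform_eq_1_iff)
qed

lemma hdisc_surj:
  assumes "w \<in> H2"
  obtains z where "z \<in> H2" "hdisc w z = Z"
proof -
  \<comment> \<open>The hyperboloid forces the axis coordinate \<open>l\<close> above
    \<open>Z\<close>; then \<open>l - Re Z\<close> is the required \<open>hcoord_\<beta>\<close> and
    determines the point.\<close>
  define l where "l = sqrt (1 + (Re Z)\<^sup>2 + (Im Z)\<^sup>2)"
  have l2: "l\<^sup>2 = 1 + (Re Z)\<^sup>2 + (Im Z)\<^sup>2" by (simp add: l_def)
  have "\<bar>Re Z\<bar> < l" unfolding l_def
    by (rule real_less_rsqrt) (simp add: add_pos_nonneg)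
  define b where "b = l - Re Z"
  have b: "b > 0" using \<open>\<bar>Re Z\<bar> < l\<close> by (simp add: b_def)
  define z' where "z' = Complex (Im Z / b) (1 / b)"
  define z where "z = Complex (Im w * Re z' + Re w) (Im w * Im z')"
  have w: "Im w > 0" using assms by (simp add: H2_def)
  have z': "Complex ((Re z - Re w) / Im w) (Im z / Im w) = z'"
    using w by (simp add: z_def complex_eq_iff)
  have "hcoord_\<alpha> z' = ((Im Z)\<^sup>2 + 1) / b"
    unfolding hcoord_\<alpha>_def cmod_power2 using b by (simp add: z'_def field_simps power2_eq_square)
  also have "\<dots> = (l + Re Z) * b / b"
    using l2 by (simp add: b_def algebra_simps power2_eq_square)
  finally have "hcoord_\<alpha> z' = l + Re Z" using b by simp
  moreover have "hcoord_\<beta> z' = l - Re Z" "hcoord_\<delta> z' = Im Z"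
    using b by (simp_all add: hcoord_defs z'_def b_def)
  ultimately have "hdisc w z = Z"
    unfolding hdisc_def Let_def z' by (simp add: complex_eq_iff)
  moreover have "z \<in> H2" using w b by (simp add: H2_def z_def z'_def)
  ultimately show thesis by (rule that[rotated])
qed

lemma orthonormal_complex:
  fixes u v :: complex
  assumes "u \<bullet> u = 1" "v \<bullet> v = 1" "u \<bullet> v = 0"
  shows "v = \<i> * u \<or> v = - (\<i> * u)" and "Z = (Z \<bullet> u) *\<^sub>R u + (Z \<bullet> v) *\<^sub>R v"
proof -
  \<comment> \<open>The determinant of \<open>u\<close> and \<open>v\<close>. Orthogonality makes
    \<open>v\<close> the multiple of \<open>\<i> * u\<close> by \<open>s\<close>, and the norms make
    \<open>s\<close> a sign.\<close>
  define s where "s = Re u * Im v - Im u * Re v"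
  have u: "Re u * Re u + Im u * Im u = 1" and v: "Re v * Re v + Im v * Im v = 1"
    and uv: "Re u * Re v + Im u * Im v = 0"
    using assms by (simp_all add: inner_complex_def)
  have "Im v = (Re u * Re u + Im u * Im u) * Im v" "Re v = (Re u * Re u + Im u * Im u) * Re v"
    unfolding u by simp_all
  moreover have "Re u * Re u * Im v + Im u * Im u * Im v = s * Re u + Im u * (Re u * Re v + Im u * Im v)"
    "Re u * Re u * Re v + Im u * Im u * Re v = - (s * Im u) + Re u * (Re u * Re v + Im u * Im v)"
    by (simp_all add: s_def algebra_simps)
  ultimately have v_eq: "Im v = s * Re u" "Re v = - (s * Im u)"
    unfolding uv by (simp_all add: algebra_simps)
  have "s * s * (Re u * Re u + Im u * Im u) = 1"
    using v unfolding v_eq by (simp add: algebra_simps)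
  then have s: "s = 1 \<or> s = - 1" unfolding u by (simp add: square_eq_1_iff)
  then show 1: "v = \<i> * u \<or> v = - (\<i> * u)"
    using v_eq by (auto simp: complex_eq_iff)
  have "Re Z = Re Z * (Re u * Re u + Im u * Im u)" "Im Z = Im Z * (Re u * Re u + Im u * Im u)"
    unfolding u by simp_all
  with 1 show "Z = (Z \<bullet> u) *\<^sub>R u + (Z \<bullet> v) *\<^sub>R v"
    by (auto simp: complex_eq_iff inner_complex_def algebra_simps)
qed

text \<open>As \<open>hform w\<close> is invariant, \<open>hform_hdisc\<close> shows that the
  induced map of the projections preserves inner products. It is determined by the images of
  \<open>1\<close> and \<open>\<i>\<close>, and is thus a rotation or a reflection of the
  plane.\<close>

lemma hisometry_fixing_hdisc:
  assumes f: "hisometry f" and w: "w \<in> H2" "f w = w"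
  obtains u where "cmod u = 1"
    "(\<forall>z\<in>H2. hdisc w (f z) = u * hdisc w z) \<or> (\<forall>z\<in>H2. hdisc w (f z) = u * cnj (hdisc w z))"
proof -
  have inner: "hdisc w (f z) \<bullet> hdisc w (f z') = hdisc w z \<bullet> hdisc w z'"
    if "z \<in> H2" "z' \<in> H2" for z z'
  proof -
    have "hform w (f z) = hform w z" if "z \<in> H2" for z
      using hisometry_hform[OF f w(1) that] w(2) by simp
    with that hform_hdisc[OF w(1) hisometry_in_H2[OF f that(1)] hisometry_in_H2[OF f that(2)]]
      hform_hdisc[OF w(1) that] hisometry_hform[OF f that]
    show ?thesis by simp
  qed
  obtain e1 where e1: "e1 \<in> H2" "hdisc w e1 = 1" using hdisc_surj[OF w(1)] by blast
  obtain e2 where e2: "e2 \<in> H2" "hdisc w e2 = \<i>" using hdisc_surj[OF w(1)] by blast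
  define u where "u = hdisc w (f e1)"
  define v where "v = hdisc w (f e2)"
  have orth: "u \<bullet> u = 1" "v \<bullet> v = 1" "u \<bullet> v = 0"
    unfolding u_def v_def using inner e1 e2 by (simp_all add: inner_complex_def)
  have img: "hdisc w (f z) = Re (hdisc w z) *\<^sub>R u + Im (hdisc w z) *\<^sub>R v" if "z \<in> H2" for z
  proof -
    have "hdisc w (f z) \<bullet> u = Re (hdisc w z)" "hdisc w (f z) \<bullet> v = Im (hdisc w z)"
      unfolding u_def v_def using inner that e1 e2 by (simp_all add: inner_complex_def)
    then show ?thesis using orthonormal_complex(2)[OF orth, of "hdisc w (f z)"] by simp
  qed
  have "cmod u = 1" using orth(1) by (simp add: norm_eq_sqrt_inner)
  moreover have "(\<forall>z\<in>H2. hdisc w (f z) = u * hdisc w z) \<or>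
      (\<forall>z\<in>H2. hdisc w (f z) = u * cnj (hdisc w z))"
    using orthonormal_complex(1)[OF orth]
  proof
    assume v: "v = \<i> * u"
    have "\<forall>z\<in>H2. hdisc w (f z) = u * hdisc w z"
      unfolding v by (simp add: img v complex_eq_iff algebra_simps)
    then show ?thesis ..
  next
    assume v: "v = - (\<i> * u)"
    have "\<forall>z\<in>H2. hdisc w (f z) = u * cnj (hdisc w z)"
      by (simp add: img v complex_eq_iff algebra_simps)
    then show ?thesis ..
  qed
  ultimately show thesis by (rule that)
qed

text \<open>The sum of a finite orbit, as vectors of the ambient space of the hyperboloid, is invariant
  and positive; rescaled to the hyperboloid it is a fixed point.\<close>

lemma finite_order_fixed_point:
  assumes f: "hisometry f" and m: "0 < m" and id: "\<And>z. z \<in> H2 \<Longrightarrow> (f ^^ m) z = z"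
  obtains w where "w \<in> H2" "f w = w"
proof -
  define p where "p k = (f ^^ k) \<i>" for k
  have i: "\<i> \<in> H2" by (simp add: H2_def)
  have p: "p k \<in> H2" for k
    unfolding p_def using hisometry_funpow[OF f] i by (rule hisometry_in_H2)
  define a b d where "a = (\<Sum>k<m. hcoord_\<alpha> (p k))" and "b = (\<Sum>k<m. hcoord_\<beta> (p k))"
    and "d = (\<Sum>k<m. hcoord_\<delta> (p k))"
  have ne: "{..<m} \<noteq> {}" using m by auto
  have b: "b > 0" unfolding b_def by (rule sum_pos) (use p m ne hcoord_\<beta>_pos in auto)
  \<comment> \<open>Positivity of the quadratic polynomial, used at its minimum
    \<open>d / b\<close>, shows that the sum of the orbit is timelike. The number \<open>c\<close>
    below is its Lorentzian length.\<close>
  have "a - 2 * d * x + b * x\<^sup>2 > 0" for x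
  proof -
    have "(\<Sum>k<m. hcoord_\<alpha> (p k) - 2 * hcoord_\<delta> (p k) * x + hcoord_\<beta> (p k) * x\<^sup>2) > 0"
    proof (rule sum_pos)
      fix k
      have "Im (p k) > 0" using p[of k] by (simp add: H2_def)
      moreover have "hcoord_\<alpha> (p k) - 2 * hcoord_\<delta> (p k) * x + hcoord_\<beta> (p k) * x\<^sup>2
          = ((Re (p k) - x)\<^sup>2 + (Im (p k))\<^sup>2) / Im (p k)"
        using \<open>Im (p k) > 0\<close> unfolding hcoord_defs cmod_power2
        by (simp add: field_simps power2_eq_square)
      ultimately show "hcoord_\<alpha> (p k) - 2 * hcoord_\<delta> (p k) * x + hcoord_\<beta> (p k) * x\<^sup>2 > 0"
        by (simp add: add_nonneg_pos)
    qed (use ne in auto)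
    then show ?thesis
      unfolding a_def b_def d_def by (simp add: sum.distrib sum_subtractf sum_distrib_left sum_distrib_right mult.assoc)
  qed
  from this[of "d / b"] have "a - d\<^sup>2 / b > 0" using b by (simp add: power2_eq_square field_simps)
  then have "a * b - d\<^sup>2 > 0" using b by (simp add: field_simps)
  define c where "c = sqrt (a * b - d\<^sup>2)"
  have c: "c > 0" "c\<^sup>2 = a * b - d\<^sup>2" using \<open>a * b - d\<^sup>2 > 0\<close> by (simp_all add: c_def)
  define w where "w = Complex (d / b) (c / b)"
  have w: "w \<in> H2" using b c by (simp add: w_def H2_def)
  have "hcoord_\<alpha> w = (d\<^sup>2 + c\<^sup>2) / (b * c)"
    unfolding hcoord_\<alpha>_def cmod_power2 using b c(1) by (simp add: w_def field_simps power2_eq_square)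
  then have "hcoord_\<alpha> w = a / c" using b c by (simp add: power2_eq_square)
  moreover have "hcoord_\<beta> w = b / c" "hcoord_\<delta> w = d / c"
    using b c(1) by (simp_all add: hcoord_defs w_def)
  ultimately have coord: "hcoord_\<alpha> w = a / c" "hcoord_\<beta> w = b / c" "hcoord_\<delta> w = d / c" .
  have form: "hform w q = (\<Sum>k<m. hform (p k) q) / c" if q: "q \<in> H2" for q
  proof -
    have sum: "(\<Sum>k<m. hform (p k) q) = (a * hcoord_\<beta> q + hcoord_\<alpha> q * b) / 2 - d * hcoord_\<delta> q"
      unfolding a_def b_def d_def
      by (simp add: hform_hcoord[OF p q] sum_subtractf sum.distrib sum_distrib_left sum_distrib_right
          flip: sum_divide_distrib)
    show ?thesis
      unfolding sum hform_hcoord[OF w q] coord by (simp add: add_divide_distrib diff_divide_distrib)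
  qed
  \<comment> \<open>Applying \<open>f\<close> only rotates the summation index of the orbit, since
    \<open>p m = p 0\<close>.\<close>
  have "hform (f w) (f q) = hform w (f q)" if q: "q \<in> H2" for q
  proof -
    have "hform (f w) (f q) = (\<Sum>k<m. hform (p k) q) / c"
      using hisometry_hform[OF f w q] form[OF q] by simp
    also have "(\<Sum>k<m. hform (p k) q) = (\<Sum>k<m. hform (p (Suc k)) (f q))"
      using hisometry_hform[OF f p q] by (simp add: p_def)
    also have "\<dots> = (\<Sum>k<m. hform (p k) (f q))"
    proof -
      have "p m = p 0" using id[OF i] by (simp add: p_def)
      then show ?thesis
        using sum.lessThan_Suc_shift[of "\<lambda>k. hform (p k) (f q)" m]
          sum.lessThan_Suc[of "\<lambda>k. hform (p k) (f q)" m] by simp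
    qed
    finally show ?thesis using form[OF hisometry_in_H2[OF f q]] by simp
  qed
  from this[OF w] have "hform w (f w) = 1"
    using hisometry_hform[OF f w w] w by (simp add: hform_eq_1_iff)
  then have "f w = w" using w hisometry_in_H2[OF f w] by (simp add: hform_eq_1_iff)
  with w show thesis by (rule that)
qed

section \<open>Stabilizers of geodesics and of segments\<close>

lemma unit_speed_geodesic_inj: "unit_speed_geodesic c \<Longrightarrow> inj c"
proof (rule injI)
  fix s t assume c: "unit_speed_geodesic c" and "c s = c t"
  then have "cosh (s - t) = 1"
    using unit_speed_geodesic_hform[OF c, of s t] unit_speed_geodesic_in_H2[OF c] by simp
  then show "s = t" by simp
qed

text \<open>In the arc-length parameter \<open>f\<close> is an isometry of the real line, hence a
  translation or a flip; a translation of finite order is trivial.\<close>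

lemma finite_order_on_geodesic:
  assumes f: "hisometry f" and c: "unit_speed_geodesic c" and img: "f ` range c = range c"
    and m: "0 < m" and id: "\<And>t. (f ^^ m) (c t) = c t"
  shows "(\<forall>t. f (c t) = c t) \<or> (\<exists>b. \<forall>t. f (c t) = c (b - t))"
proof -
  have "\<forall>t. \<exists>s. f (c t) = c s" using img by blast
  then obtain \<phi> where \<phi>: "f (c t) = c (\<phi> t)" for t by metis
  have iso: "\<bar>\<phi> s - \<phi> t\<bar> = \<bar>s - t\<bar>" for s t
    using f c \<phi> unfolding hisometry_def unit_speed_geodesic_def by metis
  have "(\<forall>t. \<phi> t = \<phi> 0 + t) \<or> (\<forall>t. \<phi> t = \<phi> 0 - t)"
  proof (rule ccontr)
    assume "\<not> ?thesis"
    then obtain s t where st: "\<phi> s \<noteq> \<phi> 0 + s" "\<phi> t \<noteq> \<phi> 0 - t" by blast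
    with iso[of s 0] iso[of t 0] have \<phi>st: "\<phi> s = \<phi> 0 - s" "\<phi> t = \<phi> 0 + t" by arith+
    with st have "s \<noteq> 0" "t \<noteq> 0" by auto
    have "\<bar>- (s + t)\<bar> = \<bar>s - t\<bar>" using iso[of s t] unfolding \<phi>st by simp
    then have "\<bar>s + t\<bar> = \<bar>s - t\<bar>" by (simp only: abs_minus)
    then have "(s + t)\<^sup>2 = (s - t)\<^sup>2" by (metis power2_abs)
    then have "s * t = 0" by (simp add: power2_eq_square algebra_simps)
    with \<open>s \<noteq> 0\<close> \<open>t \<noteq> 0\<close> show False by simp
  qed
  then show ?thesis
  proof
    assume shift: "\<forall>t. \<phi> t = \<phi> 0 + t"
    define b where "b = \<phi> 0"
    have b: "f (c t) = c (b + t)" for t unfolding b_def using \<phi>[of t] spec[OF shift, of t] by (simp only:)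
    have "(f ^^ k) (c 0) = c (real k * b)" for k
      by (induction k) (simp_all add: b algebra_simps)
    from this[of m] have "c 0 = c (real m * b)" using id by simp
    then have "0 = real m * b" by (rule injD[OF unit_speed_geodesic_inj[OF c]])
    then have "b = 0" using m by simp
    then show ?thesis using b by simp
  next
    assume flip: "\<forall>t. \<phi> t = \<phi> 0 - t"
    have "f (c t) = c (\<phi> 0 - t)" for t using \<phi>[of t] spec[OF flip, of t] by (simp only:)
    then show ?thesis by blast
  qed
qed

lemma iso_pow_mult_nat:
  assumes f: "hisometry f" and z: "z \<in> H2"
  shows "(iso_pow f i ^^ k) z = iso_pow f (int k * i) z"
proof (induction k)
  case (Suc k)
  have "(iso_pow f i ^^ Suc k) z = iso_pow f (i + int k * i) z"
    using Suc iso_pow_add[OF f z, of i "int k * i"] by simp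
  then show ?case by (simp add: algebra_simps)
qed simp

lemma iso_pow_multiple_of_order:
  assumes f: "hisometry f" and id: "\<And>z. z \<in> H2 \<Longrightarrow> iso_pow f m z = z" and z: "z \<in> H2"
  shows "iso_pow f (m * l) z = z"
proof -
  have "iso_pow f (m * int k) z = z" for k
  proof -
    have "(iso_pow f m ^^ k) z = z" by (induction k) (use id z in auto)
    then show ?thesis using iso_pow_mult_nat[OF f z, of k m] by (simp add: mult.commute)
  qed
  then have nat: "iso_pow f (m * l) z = z" if "l \<ge> 0" for l
    using that nonneg_int_cases by metis
  show ?thesis
  proof (cases "l \<ge> 0")
    case False
    then have "iso_pow f (m * (- l)) z = z" by (intro nat) simp
    then show ?thesis using iso_pow_minus[OF f z, of "m * (- l)"] by simp
  qed (rule nat)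
qed

lemma rotation_iso_pow:
  assumes f: "hisometry f" and w: "w \<in> H2" and "u \<noteq> 0"
    and rot: "\<And>z. z \<in> H2 \<Longrightarrow> hdisc w (f z) = u * hdisc w z" and z: "z \<in> H2"
  shows "hdisc w (iso_pow f i z) = u powi i * hdisc w z"
proof (induction i rule: int_induct[where k = 0])
  case (step1 i)
  then show ?case
    using \<open>u \<noteq> 0\<close> rot[OF iso_pow_in_H2[OF f z]] by (simp add: iso_pow_Suc[OF f z] power_int_add_1')
next
  case (step2 i)
  have "hdisc w (iso_pow f i z) = u * hdisc w (iso_pow f (i - 1) z)"
    using iso_pow_Suc[OF f z, of "i - 1"] rot[OF iso_pow_in_H2[OF f z]] by simp
  with step2 have "u * hdisc w (iso_pow f (i - 1) z) = u powi i * hdisc w z" by simp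
  moreover have "u powi i = u * u powi (i - 1)"
    using \<open>u \<noteq> 0\<close> by (simp add: power_int_diff)
  ultimately show ?case using \<open>u \<noteq> 0\<close> by simp
qed simp

lemma hdisc_self: "w \<in> H2 \<Longrightarrow> hdisc w w = 0"
  using norm_hdisc[of w w] by simp

text \<open>Finite order gives a fixed point \<open>w\<close>, about which \<open>f\<close> is a
  reflection, hence an involution, or a rotation. In the second case a nontrivial power preserving
  the geodesic fixes a point on it, which can only be \<open>w\<close>. Then \<open>f\<close>
  preserves the geodesic too, so the square of its rotation factor is 1.\<close>

lemma finite_order_stabilizer:
  assumes f: "hisometry f" and c: "unit_speed_geodesic c" and m: "0 < m"
    and id: "\<And>z. z \<in> H2 \<Longrightarrow> iso_pow f (int m) z = z"
    and disj: "range c \<inter> f ` range c = {} \<or> range c = f ` range c"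
    and stab: "iso_pow f j ` range c = range c"
    and nontrivial: "z\<^sub>0 \<in> H2" "iso_pow f j z\<^sub>0 \<noteq> z\<^sub>0" and z: "z \<in> H2"
  shows "f (f z) = z"
proof -
  have id': "(f ^^ m) z = z" if "z \<in> H2" for z
    using id[OF that] by (simp add: iso_pow_int)
  obtain w where w: "w \<in> H2" "f w = w"
    by (rule finite_order_fixed_point[OF f m id'])
  obtain u where u: "cmod u = 1" "(\<forall>z\<in>H2. hdisc w (f z) = u * hdisc w z) \<or>
      (\<forall>z\<in>H2. hdisc w (f z) = u * cnj (hdisc w z))"
    by (rule hisometry_fixing_hdisc[OF f w])
  have fz: "f z \<in> H2" if "z \<in> H2" for z using hisometry_in_H2[OF f that] .
  have c_H2: "c t \<in> H2" for t using unit_speed_geodesic_in_H2[OF c] .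
  from u(2) show ?thesis
  proof
    assume reflection: "\<forall>z\<in>H2. hdisc w (f z) = u * cnj (hdisc w z)"
    have "hdisc w (f (f z)) = u * cnj u * hdisc w z"
      using reflection fz z by simp
    also have "\<dots> = hdisc w z"
      using u(1) by (simp add: complex_norm_square[symmetric])
    finally show ?thesis using hdisc_inject w(1) fz z by blast
  next
    assume rot: "\<forall>z\<in>H2. hdisc w (f z) = u * hdisc w z"
    have "u \<noteq> 0" using u(1) by auto
    have rotj: "hdisc w (iso_pow f j z) = u powi j * hdisc w z" if "z \<in> H2" for z
      by (rule rotation_iso_pow[OF f w(1) \<open>u \<noteq> 0\<close> _ that]) (use rot in blast)
    have "\<exists>t. iso_pow f j (c t) = c t"
    proof -
      have "(iso_pow f j ^^ m) (c t) = c t" for t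
        using iso_pow_mult_nat[OF f c_H2] iso_pow_multiple_of_order[OF f id c_H2] by simp
      from finite_order_on_geodesic[OF hisometry_iso_pow[OF f] c stab m this]
      show ?thesis
      proof
        assume "\<exists>b. \<forall>t. iso_pow f j (c t) = c (b - t)"
        then obtain b where "\<forall>t. iso_pow f j (c t) = c (b - t)" ..
        from spec[OF this, of "b / 2"] have "iso_pow f j (c (b / 2)) = c (b / 2)" by (simp add: field_simps)
        then show ?thesis ..
      qed blast
    qed
    then obtain t where t: "iso_pow f j (c t) = c t" ..
    have "u powi j \<noteq> 1"
    proof
      assume "u powi j = 1"
      then have "hdisc w (iso_pow f j z\<^sub>0) = hdisc w z\<^sub>0" using rotj nontrivial by simp
      then show False
        using hdisc_inject[OF w(1) iso_pow_in_H2[OF f nontrivial(1)]] nontrivial by blast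
    qed
    with rotj[OF c_H2, of t] t have "hdisc w (c t) = 0" by simp
    then have "c t = w" using hdisc_inject[OF w(1) c_H2 w(1)] hdisc_self[OF w(1)] by simp
    \<comment> \<open>The geodesic meets its image in \<open>w\<close>, so \<open>disj\<close>
      leaves only equality.\<close>
    then have "w \<in> range c \<inter> f ` range c" using w(2) by (metis IntI image_eqI rangeI)
    then have img: "f ` range c = range c" using disj by blast
    have "(f ^^ m) (c s) = c s" for s using id' c_H2 by blast
    from finite_order_on_geodesic[OF f c img m this]
    have ff: "f (f (c s)) = c s" for s by auto
    obtain s where s: "c s \<noteq> w"
      using injD[OF unit_speed_geodesic_inj[OF c], of 0 1] by (metis zero_neq_one)
    then have "hdisc w (c s) \<noteq> 0"
      using hdisc_inject[OF w(1) c_H2 w(1)] hdisc_self[OF w(1)] by metis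
    moreover have "hdisc w (c s) = u * u * hdisc w (c s)"
      using rot fz c_H2 ff[of s] by (metis mult.assoc)
    ultimately have "u * u = 1" by simp
    then have "hdisc w (f (f z)) = hdisc w z"
      using rot fz z by (metis mult.assoc mult_1)
    then show ?thesis using hdisc_inject w(1) fz z by blast
  qed
qed

text \<open>Only the end points of the segment are at distance \<open>L\<close>, so \<open>f\<close>
  keeps or exchanges them; its square fixes both and is therefore an involution.\<close>

lemma segment_stabilizer:
  assumes f: "hisometry f" and c: "unit_speed_geodesic c" and L: "0 < L"
    and stab: "f ` c ` {0..L} = c ` {0..L}" and z: "z \<in> H2"
  shows "f (f (f (f z))) = z"
proof -
  have c_H2: "c t \<in> H2" for t using unit_speed_geodesic_in_H2[OF c] .
  have "f (c 0) \<in> c ` {0..L}" "f (c L) \<in> c ` {0..L}" using stab L by auto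
  then obtain a b where ab: "f (c 0) = c a" "f (c L) = c b" "a \<in> {0..L}" "b \<in> {0..L}" by blast
  have "hdist (c a) (c b) = hdist (c 0) (c L)"
    using f c_H2 ab by (metis hisometry_def)
  then have "\<bar>a - b\<bar> = L" using c L by (simp add: unit_speed_geodesic_def)
  then have "a = 0 \<and> b = L \<or> a = L \<and> b = 0" using ab(3,4) by auto
  then have "(f \<circ> f) (c 0) = c 0" "(f \<circ> f) (c L) = c L" using ab by auto
  moreover have "c 0 \<noteq> c L" using injD[OF unit_speed_geodesic_inj[OF c], of 0 L] L by auto
  ultimately have "(f \<circ> f) ((f \<circ> f) z) = z"
    using hisometry_fixes_two[OF hisometry_compose[OF f f] c_H2 c_H2] z by blast
  then show ?thesis by simp
qed

lemma ortho_segment_stabilizer: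
  assumes f: "hisometry f" and "ortho_segment s L a b" and "f ` s = s" and "z \<in> H2"
  shows "f (f (f (f z))) = z"
proof -
  obtain c where "unit_speed_geodesic c" "0 < L" "s = c ` {0..L}"
    using assms(2) unfolding ortho_segment_def by blast
  with assms show ?thesis by (auto intro: segment_stabilizer)
qed

lemma meets_orthogonally_mem: "meets_orthogonally c t a \<Longrightarrow> c t \<in> a"
  unfolding meets_orthogonally_def by (metis rangeI)

text \<open>The end points of a segment are its only two points at distance \<open>L\<close>.\<close>

lemma ortho_segment_ends:
  assumes "ortho_segment s L a b" "ortho_segment s L a' b'"
  obtains x y where "x \<in> a" "y \<in> b" "x \<in> a' \<and> y \<in> b' \<or> x \<in> b' \<and> y \<in> a'"
proof -
  obtain c where c: "unit_speed_geodesic c" "0 < L" "s = c ` {0..L}" "c 0 \<in> a" "c L \<in> b"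
    using assms(1) unfolding ortho_segment_def by (blast intro: meets_orthogonally_mem)
  obtain d where d: "unit_speed_geodesic d" "s = d ` {0..L}" "d 0 \<in> a'" "d L \<in> b'"
    using assms(2) unfolding ortho_segment_def by (blast intro: meets_orthogonally_mem)
  have "c 0 \<in> s" "c L \<in> s" using c by auto
  then obtain p q where pq: "c 0 = d p" "c L = d q" "p \<in> {0..L}" "q \<in> {0..L}"
    using d(2) by blast
  have "\<bar>p - q\<bar> = \<bar>0 - L\<bar>" using c(1) d(1) pq(1,2) unfolding unit_speed_geodesic_def by metis
  then have "p = 0 \<and> q = L \<or> p = L \<and> q = 0" using pq(3,4) c(2) by auto
  then have "c 0 \<in> a' \<and> c L \<in> b' \<or> c 0 \<in> b' \<and> c L \<in> a'" using d pq by auto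
  with c show thesis by (intro that)
qed

section \<open>Half-planes\<close>

lemma open_H2: "open H2"
  unfolding H2_def by (rule open_halfspace_Im_gt)

lemma connected_H2: "connected H2"
  unfolding H2_def by (rule convex_connected) (rule convex_halfspace_Im_gt)

lemma continuous_on_hform: "w \<in> H2 \<Longrightarrow> continuous_on H2 (\<lambda>z. hform z w)"
  unfolding hform_def by (intro continuous_intros) (auto simp: H2_def)

text \<open>With \<open>r = cmod (z - w)\<close> the height of \<open>z\<close> is at most
  \<open>Im w + r\<close>, and \<open>r\<^sup>2 / (Im w + r)\<close> increases with
  \<open>r\<close>. This lets hyperbolic closeness control Euclidean closeness.\<close>

lemma hform_lower_bound:
  assumes "z \<in> H2" "w \<in> H2" "0 < e" "e \<le> cmod (z - w)"
  shows "1 + e\<^sup>2 / (2 * Im w * (Im w + e)) \<le> hform z w"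
proof -
  define r where "r = cmod (z - w)"
  have pos: "Im z > 0" "Im w > 0" using assms by (simp_all add: H2_def)
  have "\<bar>Im (z - w)\<bar> \<le> r" unfolding r_def by (rule abs_Im_le_cmod)
  then have z: "Im z \<le> Im w + r" by simp
  have "e \<le> r" using assms by (simp add: r_def)
  have "e\<^sup>2 * (Im w + r) \<le> r\<^sup>2 * (Im w + e)"
  proof -
    have "e\<^sup>2 * Im w \<le> r\<^sup>2 * Im w"
      using \<open>e \<le> r\<close> \<open>0 < e\<close> pos by (intro mult_right_mono power_mono) auto
    moreover have "e * r * e \<le> e * r * r"
      using \<open>e \<le> r\<close> \<open>0 < e\<close> by (intro mult_left_mono) auto
    ultimately show ?thesis by (simp add: power2_eq_square algebra_simps)
  qed
  then have "e\<^sup>2 / (Im w + e) \<le> r\<^sup>2 / (Im w + r)"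
    using pos \<open>0 < e\<close> \<open>e \<le> r\<close> by (simp add: divide_le_eq le_divide_eq pos_divide_le_eq field_simps)
  also have "\<dots> \<le> r\<^sup>2 / Im z"
    using z pos by (intro divide_left_mono) auto
  finally have "e\<^sup>2 / (Im w + e) / (2 * Im w) \<le> r\<^sup>2 / Im z / (2 * Im w)"
    using pos by (intro divide_right_mono) auto
  then show ?thesis
    unfolding hform_eq[OF assms(1,2)] r_def by (simp add: mult_ac)
qed

lemma hisometry_continuous_on:
  assumes f: "hisometry f"
  shows "continuous_on H2 f"
  unfolding continuous_on_def
proof (intro ballI tendstoI)
  fix w and e :: real assume w: "w \<in> H2" and "0 < e"
  define K where "K = 1 + e\<^sup>2 / (2 * Im (f w) * (Im (f w) + e))"
  have fw: "f w \<in> H2" using f w by (rule hisometry_in_H2)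
  have "((\<lambda>z. hform z w) \<longlongrightarrow> hform w w) (at w within H2)"
    using continuous_on_hform[OF w] w unfolding continuous_on_def by blast
  moreover have "hform w w < K"
    using w fw \<open>0 < e\<close> by (simp add: K_def H2_def)
  ultimately have "\<forall>\<^sub>F z in at w within H2. hform z w < K"
    by (rule order_tendstoD(2))
  moreover have "\<forall>\<^sub>F z in at w within H2. z \<in> H2"
    by (simp add: eventually_at_filter)
  ultimately show "\<forall>\<^sub>F z in at w within H2. dist (f z) (f w) < e"
  proof eventually_elim
    case (elim z)
    have fz: "f z \<in> H2" using f elim(2) by (rule hisometry_in_H2)
    have "hform (f z) (f w) < K" using elim hisometry_hform[OF f _ w] by simp
    then show ?case
      using hform_lower_bound[OF fz fw \<open>0 < e\<close>] by (force simp: K_def dist_norm)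
  qed
qed

lemma unit_speed_geodesic_continuous_on:
  assumes "unit_speed_geodesic c"
  shows "continuous_on S c"
proof (rule continuous_at_imp_continuous_on, rule ballI)
  fix t
  show "isCont c t"
    using unit_speed_geodesic_differentiable[OF assms, of t] has_vector_derivative_continuous by blast
qed

lemma abs_le_2_cosh: "\<bar>t\<bar> \<le> 2 * cosh (t::real)"
proof -
  have "\<bar>t\<bar> \<le> exp \<bar>t\<bar>" using exp_ge_add_one_self[of "\<bar>t\<bar>"] by linarith
  also have "\<dots> \<le> exp t + exp (- t)" by (cases "t \<ge> 0") auto
  finally show ?thesis by (simp add: cosh_def)
qed

text \<open>On the neighbourhood \<open>U\<close> of \<open>p\<close> the distance from
  \<open>c 0\<close> is bounded, so only a compact, hence closed, arc of the geodesic can meet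
  it.\<close>

lemma open_H2_minus_geodesic:
  assumes c: "unit_speed_geodesic c"
  shows "open (H2 - range c)"
  unfolding open_subopen[of "H2 - range c"]
proof
  fix p assume p: "p \<in> H2 - range c"
  have c0: "c 0 \<in> H2" using unit_speed_geodesic_in_H2[OF c] .
  define K where "K = hform p (c 0) + 1"
  define U where "U = H2 \<inter> (\<lambda>z. hform z (c 0)) -` {..<K}"
  have "open U" unfolding U_def
    by (rule continuous_open_preimage[OF continuous_on_hform[OF c0] open_H2]) simp
  moreover have "closed (c ` {- 2 * K..2 * K})"
    by (intro compact_imp_closed compact_continuous_image unit_speed_geodesic_continuous_on[OF c]) simp
  ultimately have "open (U - c ` {- 2 * K..2 * K})" by (rule open_Diff)
  moreover have "p \<in> U - c ` {- 2 * K..2 * K}" using p by (auto simp: U_def K_def)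
  moreover have "U - c ` {- 2 * K..2 * K} \<subseteq> H2 - range c"
  proof
    fix z assume z: "z \<in> U - c ` {- 2 * K..2 * K}"
    have "z \<noteq> c t" for t
    proof
      assume "z = c t"
      with z have "cosh t < K"
        using unit_speed_geodesic_hform[OF c, of t 0] by (simp add: U_def)
      then have "t \<in> {- 2 * K..2 * K}" using abs_le_2_cosh[of t] by (simp add: abs_le_iff)
      with z \<open>z = c t\<close> show False by blast
    qed
    then show "z \<in> H2 - range c" using z by (auto simp: U_def)
  qed
  ultimately show "\<exists>T. open T \<and> p \<in> T \<and> T \<subseteq> H2 - range c" by blast
qed

text \<open>If \<open>H\<close> meets \<open>f ` H\<close>, then \<open>f ` H = H\<close>, so \<open>H\<close> is closed in the complement of \<open>g\<close> and in
  that of the disjoint set \<open>f ` g\<close>, hence in the connected set \<open>H2\<close>, in which it is also open.\<close>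

lemma half_plane_translate_disjoint:
  assumes f: "hisometry f" and f': "hisometry f'"
    and inv: "\<And>z. z \<in> H2 \<Longrightarrow> f (f' z) = z" "\<And>z. z \<in> H2 \<Longrightarrow> f' (f z) = z"
    and g: "hgeodesic g" and H: "H \<in> components (H2 - g)"
    and disj: "g \<inter> f ` g = {}" "H \<inter> f ` g = {}" "H \<inter> f' ` g = {}"
  shows "H \<inter> f ` H = {}"
proof (rule ccontr)
  assume "H \<inter> f ` H \<noteq> {}"
  then obtain x where x: "x \<in> H" "f x \<in> H" by blast
  obtain c where c: "unit_speed_geodesic c" "g = range c"
    using g unfolding hgeodesic_def by blast
  have gH2: "g \<subseteq> H2" using c unit_speed_geodesic_in_H2 by blast
  have HH2: "H \<subseteq> H2" "H \<inter> g = {}" using in_components_subset[OF H] by auto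
  have "connected H" using H by (rule in_components_connected)
  \<comment> \<open>One point of \<open>H\<close> sent into \<open>H\<close> suffices, because the
    image is connected and avoids \<open>g\<close>.\<close>
  have sub: "h ` H \<subseteq> H"
    if h: "hisometry h" "hisometry h'" "\<And>z. z \<in> H2 \<Longrightarrow> h' (h z) = z" "H \<inter> h' ` g = {}"
      "y \<in> H" "h y \<in> H" for h h' y
  proof (rule components_maximal[OF H])
    show "connected (h ` H)"
      by (rule connected_continuous_image[OF continuous_on_subset[OF hisometry_continuous_on[OF h(1)] HH2(1)] \<open>connected H\<close>])
    show "h ` H \<subseteq> H2 - g"
    proof safe
      fix z assume "z \<in> H"
      then show "h z \<in> H2" using HH2 hisometry_in_H2[OF h(1)] by blast
      assume "h z \<in> g"
      then have "h' (h z) \<in> h' ` g" by blast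
      moreover have "h' (h z) = z" using h(3) HH2 \<open>z \<in> H\<close> by blast
      ultimately show False using h(4) \<open>z \<in> H\<close> by auto
    qed
    show "H \<inter> h ` H \<noteq> {}" using h(5,6) by blast
  qed
  have fH: "f ` H \<subseteq> H" by (rule sub[OF f f' inv(2) disj(3) x])
  have "f' ` H \<subseteq> H"
    by (rule sub[OF f' f inv(1) disj(2), of "f x"]) (use x inv HH2 in auto)
  then have "H \<subseteq> f ` H" using inv(1) HH2(1) by (metis image_eqI image_subset_iff subset_iff)
  with fH have img: "f ` H = H" by (rule subset_antisym)
  have closed_g: "closedin (top_of_set (H2 - g)) H"
    by (rule closedin_component[OF H])
  have "closedin (top_of_set (H2 - f ` g)) ((H2 - f ` g) \<inter> f' -` H)"
  proof (rule continuous_closedin_preimage_gen[OF _ _ closed_g])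
    show "continuous_on (H2 - f ` g) f'"
      by (rule continuous_on_subset[OF hisometry_continuous_on[OF f']]) auto
    show "f' \<in> H2 - f ` g \<rightarrow> H2 - g"
    proof
      fix z assume z: "z \<in> H2 - f ` g"
      then have "f (f' z) = z" by (simp add: inv(1))
      then have "f' z \<notin> g" using z by (metis DiffE image_eqI)
      then show "f' z \<in> H2 - g" using z hisometry_in_H2[OF f'] by blast
    qed
  qed
  moreover have "(H2 - f ` g) \<inter> f' -` H = H"
  proof
    show "(H2 - f ` g) \<inter> f' -` H \<subseteq> H"
    proof
      fix z assume "z \<in> (H2 - f ` g) \<inter> f' -` H"
      then have "f' z \<in> H" "f (f' z) = z" using inv(1) by auto
      then show "z \<in> H" using img by (metis image_eqI)
    qed
    show "H \<subseteq> (H2 - f ` g) \<inter> f' -` H"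
      using HH2 disj(2) \<open>f' ` H \<subseteq> H\<close> by blast
  qed
  ultimately have closed_fg: "closedin (top_of_set (H2 - f ` g)) H" by simp
  \<comment> \<open>A limit point of \<open>H\<close> lies off \<open>g\<close> or off the image of
    \<open>g\<close> under \<open>f\<close>, as these are disjoint; \<open>H\<close> is relatively
    closed in the complement of each.\<close>
  have "closedin (top_of_set H2) H"
    unfolding closedin_limpt
  proof (intro conjI allI impI)
    fix p assume p: "p islimpt H \<and> p \<in> H2"
    show "p \<in> H"
    proof (cases "p \<in> g")
      case True
      then have "p \<in> H2 - f ` g" using disj(1) p by blast
      then show ?thesis using closed_fg p unfolding closedin_limpt by blast
    next
      case False
      then show ?thesis using closed_g p unfolding closedin_limpt by blast
    qed
  qed (fact HH2)
  moreover have "open H"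
    using open_components[OF open_H2_minus_geodesic[OF c(1)]] H c(2) by simp
  then have "openin (top_of_set H2) H" using HH2(1) by (rule open_subset[rotated])
  ultimately have "H = H2"
    using connected_H2 x(1) unfolding connected_clopen by blast
  then show False using HH2 gH2 c(2) by blast
qed

section \<open>Ortho spectra\<close>

lemma balanced_set_vimage_covering_map:
  assumes "1 \<le> n" "X' \<subseteq> cycle_vertices n" "card X' = n"
  shows "balanced_set (covering_map n -` X') n"
proof
  show "i + 2 * int n \<in> covering_map n -` X' \<longleftrightarrow> i \<in> covering_map n -` X'" for i
    by (simp add: covering_map_def)
  have "covering_map n -` X' \<inter> {0..<2 * int n} = X'"
    using assms(2) unfolding covering_map_def cycle_vertices_def by (auto simp: subset_iff)
  then show "card (covering_map n -` X' \<inter> {0..<2 * int n}) = n" using assms(3) by simp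
qed (fact assms(1))

lemma ortho_segment_subset_H2: "ortho_segment s L a b \<Longrightarrow> s \<subseteq> H2"
  unfolding ortho_segment_def by (auto simp: unit_speed_geodesic_in_H2)

lemma iso_pow_0_image [simp]: "iso_pow f 0 ` S = S"
  by (simp add: image_def)

lemma ortho_segment_iso_pow:
  assumes f: "hisometry f" and "a \<subseteq> H2" "b \<subseteq> H2"
    and s: "ortho_segment s L (iso_pow f i ` a) (iso_pow f j ` b)"
  shows "ortho_segment (iso_pow f k ` s) L (iso_pow f (i + k) ` a) (iso_pow f (j + k) ` b)"
  using hisometry_ortho_segment[OF hisometry_iso_pow[OF f] s, of k] assms(2,3)
  by (simp add: iso_pow_image_add[OF f] add.commute)

lemma eqpoll_class_eq:
  assumes "A \<approx> B"
  shows "{S. S \<approx> A} = {S. S \<approx> B}"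
proof (intro Collect_cong iffI)
  show "S \<approx> B" if "S \<approx> A" for S using that assms by (rule eqpoll_trans)
  show "S \<approx> A" if "S \<approx> B" for S using that eqpoll_sym[OF assms] by (rule eqpoll_trans)
qed

text \<open>The objects are segments with an unordered pair of labels; a shift moves the segment by
  a power of \<open>f\<close> and also the integer in each label.\<close>

lemma balanced_joining_family:
  assumes f: "hisometry f" and X: "balanced_set X n" and \<G>: "\<And>a. a \<in> \<G> \<Longrightarrow> a \<subseteq> H2"
  shows "balanced_joining X n
    (\<lambda>i j x. \<exists>a\<in>\<G>. \<exists>b\<in>\<G>. snd x = {(i, a), (j, b)} \<and>
       ortho_segment (fst x) L (iso_pow f i ` a) (iso_pow f j ` b))
    (\<lambda>k x. (iso_pow f k ` fst x, apfst (\<lambda>i. i + k) ` snd x))"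
    (is "balanced_joining X n ?R ?P")
proof (rule balanced_joining.intro[OF X], unfold_locales)
  show "?R (i + k) (j + k) (?P k x)" if R: "?R i j x" for i j x k
  proof -
    obtain a b where "a \<in> \<G>" "b \<in> \<G>" "snd x = {(i, a), (j, b)}"
      "ortho_segment (fst x) L (iso_pow f i ` a) (iso_pow f j ` b)" using R by blast
    then show ?thesis
      by (intro bexI[of _ a] bexI[of _ b]) (simp_all add: ortho_segment_iso_pow[OF f \<G> \<G>])
  qed
  show "?P k (?P l x) = ?P (k + l) x" if R: "?R i j x" for i j x k l
  proof -
    have "fst x \<subseteq> H2" using R ortho_segment_subset_H2 by blast
    then have "iso_pow f k ` iso_pow f l ` fst x = iso_pow f (k + l) ` fst x"
      by (rule iso_pow_image_add[OF f])
    moreover have "apfst (\<lambda>i. i + k) ` apfst (\<lambda>i. i + l) ` e = apfst (\<lambda>i. i + (k + l)) ` e"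
      for e :: "(int \<times> complex set) set"
      unfolding image_image by (rule image_cong) (auto simp: add_ac)
    ultimately show ?thesis by (simp only: fst_conv snd_conv)
  qed
  show "?P 0 x = x" for x :: "complex set \<times> (int \<times> complex set) set"
    by (simp add: apfst_def map_prod_def)
qed

lemma family_spectrum_over_Compl:
  assumes f: "hisometry f" and X: "balanced_set X n" and \<G>: "\<And>a. a \<in> \<G> \<Longrightarrow> a \<subseteq> H2"
  shows "family_spectrum_over f \<G> X = family_spectrum_over f \<G> (- X)"
proof
  fix L
  let ?R = "\<lambda>i j x. \<exists>a\<in>\<G>. \<exists>b\<in>\<G>. snd x = {(i, a), (j, b)} \<and>
    ortho_segment (fst x) L (iso_pow f i ` a) (iso_pow f j ` b)"
  let ?P = "\<lambda>k x. (iso_pow f k ` fst x, apfst (\<lambda>i. i + k) ` snd x)"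
  interpret balanced_joining X n ?R ?P
    by (rule balanced_joining_family[OF f X \<G>])
  have joined: "joined Y = ortho_geodesics_family (Y \<times> \<G>) (\<lambda>(i, a). iso_pow f i ` a) L" for Y
    unfolding joined_def ortho_geodesics_family_def by (auto simp: prod_eq_iff)
  have "joined X \<approx> joined (- X)"
  proof (rule free_joined_eqpoll_Compl)
    fix i j x k
    assume "?R i j x" and stab: "?P k x = x"
    then obtain a b where x: "snd x = {(i, a), (j, b)}" by blast
    have "apfst (\<lambda>i. i + k) ` snd x = snd x" using stab by (simp add: prod_eq_iff)
    then have "fst ` apfst (\<lambda>i. i + k) ` {(i, a), (j, b)} = fst ` {(i, a), (j, b)}"
      unfolding x by simp
    \<comment> \<open>A nonzero shift moves every nonempty finite set of integers, so the labels
      make the action free even if \<open>f\<close> has finite order.\<close>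
    then have "{i + k, j + k} = {i, j}" by simp
    then show "k = 0" by (auto simp: doubleton_eq_iff)
  qed
  then show "family_spectrum_over f \<G> X L = family_spectrum_over f \<G> (- X) L"
    unfolding family_spectrum_over_def ortho_spectrum_family_def joined by (rule eqpoll_class_eq)
qed

text \<open>As \<open>f\<close> is not an involution, \<open>finite_order_stabilizer\<close> shows
  that neither the power \<open>k\<close> nor \<open>- k\<close> preserves \<open>g\<close>. Both
  translates of \<open>g\<close> then lie in \<open>C\<close>, a component other than
  \<open>H\<close>, and \<open>half_plane_translate_disjoint\<close> applies.\<close>

lemma half_plane_translates_disjoint:
  assumes f: "hisometry f" and m: "0 < m" and id: "\<And>z. z \<in> H2 \<Longrightarrow> iso_pow f (int m) z = z"
    and not_involution: "z\<^sub>0 \<in> H2" "f (f z\<^sub>0) \<noteq> z\<^sub>0"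
    and g: "hgeodesic g" and disj: "\<And>i. g \<inter> iso_pow f i ` g = {} \<or> g = iso_pow f i ` g"
    and C: "C \<in> components (H2 - g)" "\<And>i. iso_pow f i ` g \<noteq> g \<Longrightarrow> iso_pow f i ` g \<subseteq> C"
    and H: "H \<in> components (H2 - g)" "\<And>i. iso_pow f i ` g \<noteq> g \<Longrightarrow> \<not> iso_pow f i ` g \<subseteq> H"
    and k: "z\<^sub>1 \<in> H2" "iso_pow f k z\<^sub>1 \<noteq> z\<^sub>1"
  shows "H \<inter> iso_pow f k ` H = {}"
proof -
  obtain c where c: "unit_speed_geodesic c" "g = range c"
    using g unfolding hgeodesic_def by blast
  have gH2: "g \<subseteq> H2" using c unit_speed_geodesic_in_H2 by blast
  have "range c \<inter> f ` range c = {} \<or> range c = f ` range c"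
    using disj[of 1] c(2) by (simp add: image_def)
  from finite_order_stabilizer[OF f c(1) m id this _ k not_involution(1)] not_involution(2)
  have ne: "iso_pow f k ` g \<noteq> g" using c(2) by blast
  have ne': "iso_pow f (- k) ` g \<noteq> g"
  proof
    assume "iso_pow f (- k) ` g = g"
    then have "iso_pow f k ` g = iso_pow f k ` iso_pow f (- k) ` g" by simp
    with ne show False using iso_pow_image_add[OF f gH2, of k "- k"] by simp
  qed
  have meet: "H \<inter> iso_pow f i ` g = {}" if "iso_pow f i ` g \<noteq> g" for i
  proof -
    have "iso_pow f i ` g \<subseteq> C" by (rule C(2)[OF that])
    moreover have "C \<inter> H = {}"
      using components_nonoverlap[OF C(1) H(1)] H(2)[OF that] C(2)[OF that] by blast
    ultimately show ?thesis by blast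
  qed
  show ?thesis
  proof (rule half_plane_translate_disjoint[OF hisometry_iso_pow[OF f] hisometry_iso_pow[OF f, of "- k"] _ _ g H(1)])
    show "iso_pow f k (iso_pow f (- k) z) = z" if "z \<in> H2" for z
      using iso_pow_minus[OF f that, of "- k"] by simp
    show "iso_pow f (- k) (iso_pow f k z) = z" if "z \<in> H2" for z
      by (rule iso_pow_minus[OF f that])
    show "g \<inter> iso_pow f k ` g = {}" using disj[of k] ne by blast
  qed (use meet ne ne' in auto)
qed

theorem theorem5p3:
  fixes g H :: "complex set" and \<gamma> :: "complex \<Rightarrow> complex" and \<G>\<^sub>0 :: "complex set set"
    and n :: nat and X' X :: "int set"
  assumes "hgeodesic g" and "hisometry \<gamma>"
    and "\<forall>i. g \<inter> iso_pow \<gamma> i ` g = {} \<or> g = iso_pow \<gamma> i ` g"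
    and "\<exists>C\<in>components (H2 - g). \<forall>i. iso_pow \<gamma> i ` g \<noteq> g \<longrightarrow> iso_pow \<gamma> i ` g \<subseteq> C"
    and "H \<in> components (H2 - g)"
    and "\<forall>i. iso_pow \<gamma> i ` g \<noteq> g \<longrightarrow> \<not> iso_pow \<gamma> i ` g \<subseteq> H"
    and "\<forall>a\<in>\<G>\<^sub>0. hgeodesic a \<and> a \<subseteq> H" and "pairwise disjnt \<G>\<^sub>0"
    and "1 \<le> n" and "X' \<subseteq> cycle_vertices n" and "card X' = n"
    and "X = covering_map n -` X'"
  shows "(compatible_with_order \<gamma> X \<longrightarrow>
            ortho_spectrum (collection_over \<gamma> \<G>\<^sub>0 X) = ortho_spectrum (collection_over \<gamma> \<G>\<^sub>0 (- X)))
         \<and> family_spectrum_over \<gamma> \<G>\<^sub>0 X = family_spectrum_over \<gamma> \<G>\<^sub>0 (- X)"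
proof (intro conjI impI ext)
  note \<gamma> = assms(2)
  have X: "balanced_set X n"
    unfolding assms(12) using assms(9-11) by (rule balanced_set_vimage_covering_map)
  have HH2: "H \<subseteq> H2" using in_components_subset[OF assms(5)] by auto
  have \<G>\<^sub>0: "a \<subseteq> H2" if "a \<in> \<G>\<^sub>0" for a using that assms(7) HH2 by blast
  show "family_spectrum_over \<gamma> \<G>\<^sub>0 X L = family_spectrum_over \<gamma> \<G>\<^sub>0 (- X) L" for L
    using family_spectrum_over_Compl[OF \<gamma> X \<G>\<^sub>0] by simp
  fix L assume compat: "compatible_with_order \<gamma> X"
  \<comment> \<open>The object is the bare segment without labels, so one \<open>s\<close> may
    belong to several pairs of indices or be fixed by a nonzero shift.\<close>
  define R where "R i j s \<longleftrightarrow>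
    (\<exists>a\<in>\<G>\<^sub>0. \<exists>b\<in>\<G>\<^sub>0. ortho_segment s L (iso_pow \<gamma> i ` a) (iso_pow \<gamma> j ` b))" for i j s
  interpret balanced_joining X n R "\<lambda>k s. iso_pow \<gamma> k ` s"
  proof (rule balanced_joining.intro[OF X], unfold_locales)
    show "R (i + k) (j + k) (iso_pow \<gamma> k ` s)" if "R i j s" for i j s k
      using that ortho_segment_iso_pow[OF \<gamma> \<G>\<^sub>0 \<G>\<^sub>0] unfolding R_def by blast
    show "iso_pow \<gamma> k ` iso_pow \<gamma> l ` s = iso_pow \<gamma> (k + l) ` s" if "R i j s" for i j s k l
    proof (rule iso_pow_image_add[OF \<gamma>])
      show "s \<subseteq> H2" using that ortho_segment_subset_H2 unfolding R_def by blast
    qed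
  qed simp
  have joined: "joined Y = ortho_geodesics (collection_over \<gamma> \<G>\<^sub>0 Y) L" for Y
    unfolding joined_def R_def ortho_geodesics_def collection_over_def translate_def by blast
  have "joined X \<approx> joined (- X)"
  proof (cases "\<exists>m. m \<noteq> 0 \<and> (\<forall>z\<in>H2. iso_pow \<gamma> m z = z)")
    case False
    show ?thesis
    proof (rule free_joined_eqpoll_Compl)
      fix i j s k
      assume "R i j s" and stab: "iso_pow \<gamma> k ` s = s"
      then obtain a b where s: "ortho_segment s L a b" unfolding R_def by blast
      \<comment> \<open>An isometry preserving a segment has trivial fourth power, while here no
        nonzero power of \<open>\<gamma>\<close> is trivial.\<close>
      have "iso_pow \<gamma> (4 * k) z = z" if "z \<in> H2" for z
        using ortho_segment_stabilizer[OF hisometry_iso_pow[OF \<gamma>] s stab that]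
          iso_pow_mult_nat[OF \<gamma> that, of 4 k] by (simp add: eval_nat_numeral)
      with False have "4 * k = 0" by blast
      then show "k = 0" by simp
    qed
  next
    case True
    then obtain m where "m \<noteq> 0" and m: "\<And>z. z \<in> H2 \<Longrightarrow> iso_pow \<gamma> m z = z" by blast
    have order: "iso_pow \<gamma> (int (nat \<bar>m\<bar>)) z = z" if "z \<in> H2" for z
      using iso_pow_multiple_of_order[OF \<gamma> m that, of "sgn m"] by (simp add: abs_sgn)
    show ?thesis
    proof (cases "\<forall>z\<in>H2. \<gamma> (\<gamma> z) = z")
      case True
      then have "\<forall>z\<in>H2. iso_pow \<gamma> 2 z = z"
        using iso_pow_int[of \<gamma> 2] by (simp add: numeral_2_eq_2)
      \<comment> \<open>Compatibility with the order, applied to the trivial power 2, gives period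
        2.\<close>
      then have "i + 2 \<in> X \<longleftrightarrow> i \<in> X" for i
        using compat unfolding compatible_with_order_def by blast
      then show ?thesis
        by (intro alternating_joined_eqpoll_Compl period_2_alternating)
    next
      case False
      then obtain z\<^sub>0 where z\<^sub>0: "z\<^sub>0 \<in> H2" "\<gamma> (\<gamma> z\<^sub>0) \<noteq> z\<^sub>0" by blast
      obtain C where C: "C \<in> components (H2 - g)"
        "\<And>i. iso_pow \<gamma> i ` g \<noteq> g \<Longrightarrow> iso_pow \<gamma> i ` g \<subseteq> C"
        using assms(4) by blast
      \<comment> \<open>If two translates of \<open>H\<close> meet, the power \<open>j - i\<close>
        is trivial by disjointness of the others, and \<open>compat\<close> identifies the
        indices.\<close>
      have same_index: "i \<in> X \<longleftrightarrow> j \<in> X" if "x \<in> iso_pow \<gamma> i ` H" "x \<in> iso_pow \<gamma> j ` H" for i j x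
      proof -
        obtain y z where yz: "y \<in> H" "z \<in> H" "x = iso_pow \<gamma> i y" "x = iso_pow \<gamma> j z"
          using \<open>x \<in> iso_pow \<gamma> i ` H\<close> \<open>x \<in> iso_pow \<gamma> j ` H\<close> by blast
        then have "y \<in> H2" "z \<in> H2" using HH2 by auto
        then have "y = iso_pow \<gamma> (j - i) z"
          using iso_pow_minus[OF \<gamma>, of y i] iso_pow_add[OF \<gamma>, of z "- i" j] yz(3,4) by simp
        with yz have meet: "H \<inter> iso_pow \<gamma> (j - i) ` H \<noteq> {}" by blast
        have "iso_pow \<gamma> (j - i) z = z" if "z \<in> H2" for z
        proof (rule ccontr)
          assume "iso_pow \<gamma> (j - i) z \<noteq> z"
          with half_plane_translates_disjoint[OF \<gamma> _ order z\<^sub>0 assms(1) _ C assms(5) _ that] meet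
          show False using \<open>m \<noteq> 0\<close> assms(3,6) by simp
        qed
        then have "i \<in> X \<longleftrightarrow> i + (j - i) \<in> X"
          using compat unfolding compatible_with_order_def by blast
        then show ?thesis by simp
      qed
      show ?thesis
      proof (rule determined_joined_eqpoll_Compl)
        fix i j i' j' s
        assume "R i j s" "R i' j' s"
        then obtain a b a' b' where in_\<G>: "a \<in> \<G>\<^sub>0" "b \<in> \<G>\<^sub>0" "a' \<in> \<G>\<^sub>0" "b' \<in> \<G>\<^sub>0"
          and s: "ortho_segment s L (iso_pow \<gamma> i ` a) (iso_pow \<gamma> j ` b)"
            "ortho_segment s L (iso_pow \<gamma> i' ` a') (iso_pow \<gamma> j' ` b')"
          unfolding R_def by blast
        have sub: "iso_pow \<gamma> k ` d \<subseteq> iso_pow \<gamma> k ` H" if "d \<in> \<G>\<^sub>0" for d k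
          using that assms(7) by blast
        \<comment> \<open>The segment is unoriented, so its ends may correspond in either order; the
          conditions on unordered pairs do not distinguish the two.\<close>
        from ortho_segment_ends[OF s] have
          "(i \<in> X \<longleftrightarrow> i' \<in> X) \<and> (j \<in> X \<longleftrightarrow> j' \<in> X) \<or> (i \<in> X \<longleftrightarrow> j' \<in> X) \<and> (j \<in> X \<longleftrightarrow> i' \<in> X)"
          using same_index sub[OF in_\<G>(1)] sub[OF in_\<G>(2)] sub[OF in_\<G>(3)] sub[OF in_\<G>(4)]
          by (metis subsetD)
        then show "({i, j} \<subseteq> X \<longleftrightarrow> {i', j'} \<subseteq> X) \<and> ({i, j} \<subseteq> - X \<longleftrightarrow> {i', j'} \<subseteq> - X)"
          by auto
      qed
    qed
  qed
  then show "ortho_spectrum (collection_over \<gamma> \<G>\<^sub>0 X) L = ortho_spectrum (collection_over \<gamma> \<G>\<^sub>0 (- X)) L"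
    unfolding ortho_spectrum_def joined by (rule eqpoll_class_eq)
qed

end
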